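(* Let $p\in[1,\infty)$, let $(\Omega,\mathcal F,(\mathcal F_t)_{t=1}^T,\mathbb P)$ be a filtered probability space, and let $Y^u=(Y^u_t)_{t=1}^T:\Omega\to\mathcal X$, $u\in[0,1]$, be a family of $(\mathcal F_t)_{t=1}^T$-adapted processes. Suppose that $\eta:=\mathrm{Law}_{\mathbb P}((Y^u)_{u\in[0,1]})\in\mathcal P(C(\mathcal X))$ is concentrated on $AC^p(\mathcal X)$, that $$\mathbb Y^0:=(\Omega,\mathcal F,(\mathcal F_t)_{t=1}^T,\mathbb P,(Y^0_t)_{t=1}^T)\in \mathrm{FP}_p,$$ and that $$\int_{C(\mathcal X)}\int_0^1|f'|^p(s)\,\mathrm ds\,\eta(\mathrm df)<\infty.$$ Then the curve $u\mapsto\mathbb Y^u:=(\Omega,\mathcal F,(\mathcal F_t)_{t=1}^T,\mathbb P,(Y^u_t)_{t=1}^T)$ is in $AC^p(\mathrm{FP}_p)$, and its metric derivative (with respect to $\mathcal{AW}_p$) satisfies $$|\mathbb Y'|^p(u)\le\int_{C(\mathcal X)}|f'|^p(u)\,\eta(\mathrm df)\quad\text{for a.e. }u\in[0,1].$$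
   Context: Path space. Fix $T\in\mathbb N$ and separable complete metric spaces $(\mathcal X_t,d_{\mathcal X_t})$, $t=1,\dots,T$; let $\mathcal X=\mathcal X_1\times\cdots\times\mathcal X_T$, with metric $d_{\mathcal X,p}(x,y)=\big(\sum_{t=1}^T d_{\mathcal X_t}(x_t,y_t)^p\big)^{1/p}$. Filtered processes. A filtered process in $\mathcal X$ is a tuple $\mathbb X=(\Omega^{\mathbb X},\mathcal F^{\mathbb X},\mathbb P^{\mathbb X},(\mathcal F^{\mathbb X}_t)_{t=1}^T,X=(X_t)_{t=1}^T)$ consisting of a filtered probability space and an adapted process $X$ with $X_t$ valued in $\mathcal X_t$. Set $\mathcal F_0^{\mathbb X}=\{\emptyset,\Omega^{\mathbb X}\}$. A coupling of $\mathbb X,\mathbb Y$ is a probability measure $\pi$ on $(\Omega^{\mathbb X}\times\Omega^{\mathbb Y},\mathcal F^{\mathbb X}\otimes\mathcal F^{\mathbb Y})$ with marginals $\mathbb P^{\mathbb X},\mathbb P^{\mathbb Y}$. It is bicausal, $\pi\in\mathrm{Cpl}_{\mathrm{bc}}(\mathbb X,\mathbb Y)$, if for every $t\in\{1,\dots,T-1\}$: $\mathcal F^{\mathbb X}_T\otimes\mathcal F^{\mathbb Y}_0$ and $\mathcal F^{\mathbb X}_0\otimes\mathcal F^{\mathbb Y}_t$ are conditionally $\pi$-independent given $\mathcal F^{\mathbb X}_t\otimes\mathcal F^{\mathbb Y}_0$, and $\mathcal F^{\mathbb X}_0\otimes\mathcal F^{\mathbb Y}_T$ and $\mathcal F^{\mathbb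 X}_t\otimes\mathcal F^{\mathbb Y}_0$ are conditionally $\pi$-independent given $\mathcal F^{\mathbb X}_0\otimes\mathcal F^{\mathbb Y}_t$. The adapted Wasserstein distance is $\mathcal{AW}_p(\mathbb X,\mathbb Y)=\inf_{\pi\in\mathrm{Cpl}_{\mathrm{bc}}(\mathbb X,\mathbb Y)}\big(\mathbb E^\pi[d_{\mathcal X,p}(X,Y)^p]\big)^{1/p}$. $\mathrm{FP}_p$ is the metric space, with metric $\mathcal{AW}_p$, of filtered processes with $\mathbb E^{\mathbb P^{\mathbb X}}[d_{\mathcal X,p}(X,x_0)^p]<\infty$ for some (all) $x_0\in\mathcal X$, where $\mathbb X,\mathbb Y$ are identified if $\mathcal{AW}_p(\mathbb X,\mathbb Y)=0$; processes and their equivalence classes are not distinguished. Absolutely continuous curves. For a metric space $(\mathcal Y,d)$, $AC^p(\mathcal Y)$ is the set of $f:[0,1]\to\mathcal Y$ for which there is $m\in L^p([0,1];\mathbb R)$ with $d(f(u),f(v))\le\int_u^v m(r)\,\mathrm dr$ for all $0\le u\le v\le1$. For a curve $f$, $|f'|(u)=\limsup_{v\to u,\,v\ne u}d(f(u),f(v))/|u-v|$; for $f\in AC^p(\mathcal Y)$ this is a limit for a.e. $u$ and is called the metric derivative. For $\mathcal Y=\mathcal X$ the metric $d_{\mathcal X,p}$ is used; for $\mathcal Y=\mathrm{FP}_p$ the metric $\mathcal{AW}_p$. $C(\mathcal X)$ is the space of continuous maps $[0,1]\to\mathcal X$ with the supremum metric. Writing $\mathrm{Law}_{\mathbb P}((Y^u)_{u\in[0,1]})\in\mathcal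 P(C(\mathcal X))$ means that $\omega\mapsto(u\mapsto Y^u(\omega))$ is ($\mathbb P$-a.s.) a $C(\mathcal X)$-valued random variable, and $\eta$ is its law. *)

theory Defs
  imports "HOL-Probability.Probability"
begin

section \<open>Path space\<close>

text \<open>The spaces \<open>X 1, \<dots>, X T\<close> are elements of \<^typ>\<open>'a metric\<close>: each has its own carrier and its own
  distance, and the common type \<^typ>\<open>'a\<close> only provides room for all of them.\<close>

definition path_dist :: "real \<Rightarrow> nat \<Rightarrow> (nat \<Rightarrow> 'a metric) \<Rightarrow> (nat \<Rightarrow> 'a) \<Rightarrow> (nat \<Rightarrow> 'a) \<Rightarrow> real" where
  "path_dist p T X x y = (\<Sum>t=1..T. mdist (X t) (x t) (y t) powr p) powr (1 / p)"

definition path_space :: "real \<Rightarrow> nat \<Rightarrow> (nat \<Rightarrow> 'a metric) \<Rightarrow> (nat \<Rightarrow> 'a) metric" where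
  "path_space p T X = metric (\<Pi>\<^sub>E t\<in>{1..T}. mspace (X t), path_dist p T X)"

text \<open>The term \<^term>\<open>metric (M, d)\<close> is meaningful only if \<^term>\<open>d\<close> is a metric on \<^term>\<open>M\<close>. For
  \<open>p \<ge> 1\<close> this is Minkowski's inequality for finite sums.\<close>

lemma powr_convex_combination:
  fixes a b p s :: real
  assumes p: "1 \<le> p" and a: "0 \<le> a" and b: "0 \<le> b" and s: "0 \<le> s" "s \<le> 1"
  shows "((1 - s) * a + s * b) powr p \<le> (1 - s) * a powr p + s * b powr p"
proof -
  have le: "r powr p \<le> r" if "0 \<le> r" "r \<le> 1" for r :: real
    using powr_mono'[of 1 p r] that p by (cases "r = 0") auto
  consider "a = 0" | "b = 0" | "0 < a" "0 < b" using a b by linarith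
  then show ?thesis
  proof cases
    case 1
    have "s powr p * b powr p \<le> s * b powr p"
      by (intro mult_right_mono le s) auto
    then show ?thesis using 1 p s b by (simp add: powr_mult)
  next
    case 2
    have "(1 - s) powr p * a powr p \<le> (1 - s) * a powr p"
      using s by (intro mult_right_mono le) auto
    then show ?thesis using 2 p s a by (simp add: powr_mult)
  next
    case 3
    then show ?thesis
      using convex_onD[OF powr_convex[OF p], of s a b] s by simp
  qed
qed

lemma minkowski_sum:
  fixes a b :: "'i \<Rightarrow> real" and p :: real
  assumes I: "finite I" and p: "1 \<le> p"
    and a: "\<And>i. i \<in> I \<Longrightarrow> 0 \<le> a i" and b: "\<And>i. i \<in> I \<Longrightarrow> 0 \<le> b i"
  shows "(\<Sum>i\<in>I. (a i + b i) powr p) powr (1/p)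
       \<le> (\<Sum>i\<in>I. a i powr p) powr (1/p) + (\<Sum>i\<in>I. b i powr p) powr (1/p)"
proof -
  define A B where "A = (\<Sum>i\<in>I. a i powr p) powr (1/p)" and "B = (\<Sum>i\<in>I. b i powr p) powr (1/p)"
  have Ap: "A powr p = (\<Sum>i\<in>I. a i powr p)" and Bp: "B powr p = (\<Sum>i\<in>I. b i powr p)"
    using p by (auto simp: A_def B_def powr_powr sum_nonneg)
  have nn: "0 \<le> A" "0 \<le> B" by (auto simp: A_def B_def)
  have za: "a i = 0" if "A = 0" "i \<in> I" for i
    using Ap that p I by (simp add: sum_nonneg_eq_0_iff)
  have zb: "b i = 0" if "B = 0" "i \<in> I" for i
    using Bp that p I by (simp add: sum_nonneg_eq_0_iff)
  consider "A = 0" | "B = 0" | "0 < A" "0 < B" using nn by linarith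
  then have "(\<Sum>i\<in>I. (a i + b i) powr p) powr (1/p) \<le> A + B"
  proof cases
    case 1
    then show ?thesis using za by (simp add: B_def)
  next
    case 2
    then show ?thesis using zb by (simp add: A_def)
  next
    case 3
    define s where "s = B / (A + B)"
    have s: "0 \<le> s" "s \<le> 1" "1 - s = A / (A + B)"
      using 3 by (auto simp: s_def field_simps)
    have AB: "0 < A + B" using 3 by simp
    have "(a i + b i) powr p
        \<le> (A + B) powr p * ((1 - s) * (a i powr p / A powr p) + s * (b i powr p / B powr p))"
      if i: "i \<in> I" for i
    proof -
      have "a i + b i = (A + B) * ((1 - s) * (a i / A) + s * (b i / B))"
      proof -
        have "(A + B) * (1 - s) = A" "(A + B) * s = B"
          unfolding s(3) using AB by (auto simp: s_def)
        then have "(A + B) * (1 - s) * (a i / A) + (A + B) * s * (b i / B) = a i + b i"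
          using 3 by simp
        then show ?thesis by (simp add: distrib_left mult.assoc)
      qed
      then have "(a i + b i) powr p = (A + B) powr p * ((1 - s) * (a i / A) + s * (b i / B)) powr p"
        using AB a[OF i] b[OF i] s 3 by (simp add: powr_mult)
      also have "\<dots> \<le> (A + B) powr p * ((1 - s) * (a i / A) powr p + s * (b i / B) powr p)"
        using a[OF i] b[OF i] s 3 by (intro mult_left_mono powr_convex_combination p) auto
      finally show ?thesis using a[OF i] b[OF i] 3 by (simp add: powr_divide)
    qed
    then have "(\<Sum>i\<in>I. (a i + b i) powr p)
        \<le> (\<Sum>i\<in>I. (A + B) powr p * ((1 - s) * (a i powr p / A powr p) + s * (b i powr p / B powr p)))"
      by (intro sum_mono) auto
    also have "\<dots> = (A + B) powr p
        * ((1 - s) * ((\<Sum>i\<in>I. a i powr p) / A powr p) + s * ((\<Sum>i\<in>I. b i powr p) / B powr p))"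
      by (simp add: sum_distrib_left[symmetric] sum.distrib sum_divide_distrib[symmetric])
    also have "\<dots> = (A + B) powr p"
      unfolding Ap[symmetric] Bp[symmetric] using 3 by simp
    finally have "(\<Sum>i\<in>I. (a i + b i) powr p) powr (1/p) \<le> ((A + B) powr p) powr (1/p)"
      using p by (intro powr_mono2) (auto simp: sum_nonneg)
    also have "\<dots> = A + B" using p AB by (simp add: powr_powr)
    finally show ?thesis .
  qed
  then show ?thesis by (simp add: A_def B_def)
qed

lemma Metric_space_path_space:
  assumes p: "1 \<le> p"
  shows "Metric_space (\<Pi>\<^sub>E t\<in>{1..T}. mspace (X t)) (path_dist p T X)"
proof
  show "0 \<le> path_dist p T X x y" for x y
    by (simp add: path_dist_def)
  show "path_dist p T X x y = path_dist p T X y x" for x y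
    by (simp add: path_dist_def mdist_commute)
next
  fix x y assume xy: "x \<in> (\<Pi>\<^sub>E t\<in>{1..T}. mspace (X t))" "y \<in> (\<Pi>\<^sub>E t\<in>{1..T}. mspace (X t))"
  have "path_dist p T X x y = 0 \<longleftrightarrow> (\<forall>t\<in>{1..T}. mdist (X t) (x t) (y t) = 0)"
    using p by (auto simp: path_dist_def sum_nonneg_eq_0_iff)
  also have "\<dots> \<longleftrightarrow> (\<forall>t\<in>{1..T}. x t = y t)"
    using xy by (intro ball_cong refl mdist_zero) (auto simp: PiE_iff)
  also have "\<dots> \<longleftrightarrow> x = y"
    using xy by (auto intro: PiE_ext)
  finally show "path_dist p T X x y = 0 \<longleftrightarrow> x = y" .
next
  fix x y z
  assume xyz: "x \<in> (\<Pi>\<^sub>E t\<in>{1..T}. mspace (X t))" "y \<in> (\<Pi>\<^sub>E t\<in>{1..T}. mspace (X t))"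
    "z \<in> (\<Pi>\<^sub>E t\<in>{1..T}. mspace (X t))"
  have "path_dist p T X x z
      \<le> (\<Sum>t=1..T. (mdist (X t) (x t) (y t) + mdist (X t) (y t) (z t)) powr p) powr (1/p)"
    unfolding path_dist_def using xyz p
    by (intro powr_mono2 sum_mono sum_nonneg mdist_triangle) (auto simp: PiE_iff)
  also have "\<dots> \<le> path_dist p T X x y + path_dist p T X y z"
    unfolding path_dist_def by (intro minkowski_sum p) auto
  finally show "path_dist p T X x z \<le> path_dist p T X x y + path_dist p T X y z" .
qed

lemma mspace_path_space [simp]:
  "1 \<le> p \<Longrightarrow> mspace (path_space p T X) = (\<Pi>\<^sub>E t\<in>{1..T}. mspace (X t))"
  unfolding path_space_def by (intro Metric_space.mspace_metric Metric_space_path_space)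

lemma mdist_path_space [simp]: "1 \<le> p \<Longrightarrow> mdist (path_space p T X) = path_dist p T X"
  unfolding path_space_def by (intro Metric_space.mdist_metric Metric_space_path_space)

definition borel_of_metric :: "'a metric \<Rightarrow> 'a measure" where
  "borel_of_metric m = sigma (mspace m) {U. openin (mtopology_of m) U}"

text \<open>The continuous maps from \<open>[0,1]\<close> to \<^term>\<open>m\<close> with the supremum metric; they are represented as
  functions on \<open>\<real>\<close> that are \<^const>\<open>undefined\<close> off \<open>[0,1]\<close>. The boundedness built into
  \<^const>\<open>cfunspace\<close> is automatic, as \<open>[0,1]\<close> is compact.\<close>

definition C_space :: "'a metric \<Rightarrow> (real \<Rightarrow> 'a) metric" where
  "C_space m = cfunspace (top_of_set {0..1}) m"


section \<open>Absolutely continuous curves\<close>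

text \<open>Intended for exponents \<open>r > 0\<close>.\<close>

definition ennreal_powr :: "ennreal \<Rightarrow> real \<Rightarrow> ennreal" where
  "ennreal_powr x r = (if x = \<top> then \<top> else ennreal (enn2real x powr r))"

text \<open>Distances take values in \<open>[0,\<infinity>]\<close> here, because the adapted Wasserstein distance below is an infimum
  in \<open>[0,\<infinity>]\<close>. As in the definition of \<open>AC\<^sup>p\<close> for real distances, \<^term>\<open>m\<close> may be replaced by its
  absolute value, so truncating a negative integral to \<open>0\<close> does not change the set of curves.\<close>

definition AC :: "real \<Rightarrow> 'y set \<Rightarrow> ('y \<Rightarrow> 'y \<Rightarrow> ennreal) \<Rightarrow> (real \<Rightarrow> 'y) set" where
  "AC p S d = {f. f \<in> {0..1} \<rightarrow> S \<and>
     (\<exists>m :: real \<Rightarrow> real. set_borel_measurable lborel {0..1} m \<and>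
        set_integrable lborel {0..1} (\<lambda>r. \<bar>m r\<bar> powr p) \<and>
        (\<forall>u v. 0 \<le> u \<and> u \<le> v \<and> v \<le> 1 \<longrightarrow> d (f u) (f v) \<le> ennreal (LINT r:{u..v}|lborel. m r)))}"

definition metric_speed :: "('y \<Rightarrow> 'y \<Rightarrow> ennreal) \<Rightarrow> (real \<Rightarrow> 'y) \<Rightarrow> real \<Rightarrow> ennreal" where
  "metric_speed d f u = Limsup (at u within {0..1}) (\<lambda>v. d (f u) (f v) / ennreal \<bar>u - v\<bar>)"

abbreviation emdist :: "'a metric \<Rightarrow> 'a \<Rightarrow> 'a \<Rightarrow> ennreal" where
  "emdist m x y \<equiv> ennreal (mdist m x y)"


section \<open>Filtered processes\<close>

text \<open>A sub-\<open>\<sigma>\<close>-algebra is represented by a measure of which only the space and the measurable sets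
  matter, as for \<^const>\<open>subalgebra\<close> and \<^const>\<open>real_cond_exp\<close>.\<close>

definition filtered_prob_space :: "nat \<Rightarrow> 'w measure \<Rightarrow> (nat \<Rightarrow> 'w measure) \<Rightarrow> bool" where
  "filtered_prob_space T P F \<longleftrightarrow> prob_space P \<and> (\<forall>t\<in>{1..T}. subalgebra P (F t)) \<and>
     (\<forall>s\<in>{1..T}. \<forall>t\<in>{1..T}. s \<le> t \<longrightarrow> sets (F s) \<subseteq> sets (F t))"

definition adapted ::
  "nat \<Rightarrow> (nat \<Rightarrow> 'a metric) \<Rightarrow> 'w measure \<Rightarrow> (nat \<Rightarrow> 'w measure) \<Rightarrow> ('w \<Rightarrow> nat \<Rightarrow> 'a) \<Rightarrow> bool" where
  "adapted T X P F Y \<longleftrightarrow> Y \<in> space P \<rightarrow> (\<Pi>\<^sub>E t\<in>{1..T}. mspace (X t)) \<and>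
     (\<forall>t\<in>{1..T}. (\<lambda>\<omega>. Y \<omega> t) \<in> measurable (F t) (borel_of_metric (X t)))"

record ('w, 'a) filtered_process =
  prob_of :: "'w measure"
  filt :: "nat \<Rightarrow> 'w measure"
  proc :: "'w \<Rightarrow> nat \<Rightarrow> 'a"

text \<open>The filtration extended by the trivial \<open>\<sigma>\<close>-algebra at time \<open>0\<close>.\<close>

definition filt0 :: "('w, 'a) filtered_process \<Rightarrow> nat \<Rightarrow> 'w measure" where
  "filt0 A t = (if t = 0 then sigma (space (prob_of A)) {} else filt A t)"

definition cond_indep :: "'w measure \<Rightarrow> 'w measure \<Rightarrow> 'w measure \<Rightarrow> 'w measure \<Rightarrow> bool" where
  "cond_indep M G H K \<longleftrightarrow> (\<forall>a\<in>sets G. \<forall>b\<in>sets H.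
     AE x in M. real_cond_exp M K (indicator (a \<inter> b)) x
              = real_cond_exp M K (indicator a) x * real_cond_exp M K (indicator b) x)"

definition couplings :: "'w measure \<Rightarrow> 'v measure \<Rightarrow> ('w \<times> 'v) measure set" where
  "couplings P Q = {\<pi>. prob_space \<pi> \<and> sets \<pi> = sets (P \<Otimes>\<^sub>M Q) \<and> distr \<pi> P fst = P \<and> distr \<pi> Q snd = Q}"

definition bicausal_couplings ::
  "nat \<Rightarrow> ('w, 'a) filtered_process \<Rightarrow> ('v, 'a) filtered_process \<Rightarrow> ('w \<times> 'v) measure set" where
  "bicausal_couplings T A B = {\<pi> \<in> couplings (prob_of A) (prob_of B). \<forall>t\<in>{1..T - 1}.
     cond_indep \<pi> (filt0 A T \<Otimes>\<^sub>M filt0 B 0) (filt0 A 0 \<Otimes>\<^sub>M filt0 B t) (filt0 A t \<Otimes>\<^sub>M filt0 B 0) \<and>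
     cond_indep \<pi> (filt0 A 0 \<Otimes>\<^sub>M filt0 B T) (filt0 A t \<Otimes>\<^sub>M filt0 B 0) (filt0 A 0 \<Otimes>\<^sub>M filt0 B t)}"

definition AW ::
  "real \<Rightarrow> nat \<Rightarrow> (nat \<Rightarrow> 'a metric) \<Rightarrow>
   ('w, 'a) filtered_process \<Rightarrow> ('v, 'a) filtered_process \<Rightarrow> ennreal" where
  "AW p T X A B = (INF \<pi>\<in>bicausal_couplings T A B.
     ennreal_powr (\<integral>\<^sup>+ (\<omega>, \<omega>'). ennreal (mdist (path_space p T X) (proc A \<omega>) (proc B \<omega>') powr p) \<partial>\<pi>)
       (1 / p))"

text \<open>The processes of \<open>FP\<^sub>p\<close> with sample space in a given type, as representatives: processes at
  \<^const>\<open>AW\<close>-distance \<open>0\<close> are identified only implicitly, that is, \<^const>\<open>AW\<close> is a pseudometric on this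
  set. \<^const>\<open>AC\<close> and \<^const>\<open>metric_speed\<close> see a curve only through the distances between its points
  and hence give the same notions as in the quotient.\<close>

definition FP :: "real \<Rightarrow> nat \<Rightarrow> (nat \<Rightarrow> 'a metric) \<Rightarrow> ('w, 'a) filtered_process set" where
  "FP p T X = {A. filtered_prob_space T (prob_of A) (filt A) \<and>
     adapted T X (prob_of A) (filt A) (proc A) \<and>
     (\<exists>x0\<in>mspace (path_space p T X).
        (\<integral>\<^sup>+ \<omega>. ennreal (mdist (path_space p T X) (proc A \<omega>) x0 powr p) \<partial>prob_of A) < \<infinity>)}"

text \<open>\<^term>\<open>has_path_law P m Y \<eta>\<close>: the map \<open>\<omega> \<mapsto> (u \<mapsto> Y u \<omega>)\<close> is \<^term>\<open>P\<close>-almost surely equal to a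
  random variable with values in \<^term>\<open>C_space m\<close>, and \<^term>\<open>\<eta>\<close> is the law of the latter (which
  does not depend on its choice).\<close>

definition has_path_law ::
  "'w measure \<Rightarrow> 'b metric \<Rightarrow> (real \<Rightarrow> 'w \<Rightarrow> 'b) \<Rightarrow> (real \<Rightarrow> 'b) measure \<Rightarrow> bool" where
  "has_path_law P m Y \<eta> \<longleftrightarrow> (\<exists>Z \<in> measurable P (borel_of_metric (C_space m)).
     (AE \<omega> in P. Z \<omega> = (\<lambda>u\<in>{0..1}. Y u \<omega>)) \<and> \<eta> = distr P (borel_of_metric (C_space m)) Z)"

end

theory Submission
  imports Defs
begin

text \<open>All the processes live on one filtered probability space, so the image of \<open>P\<close> under
\<open>\<omega> \<mapsto> (\<omega>, \<omega>)\<close> couples \<open>Y\<^sup>u\<close> with \<open>Y\<^sup>v\<close>. This diagonal coupling is bicausal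
(\<open>diagonal_coupling_bicausal\<close>): on the diagonal an event of one coordinate at time \<open>t\<close> is an event of
the other coordinate at time \<open>t\<close>. Hence the adapted distance of \<open>Y\<^sup>u\<close> and \<open>Y\<^sup>v\<close>, raised to the
power \<open>p\<close>, is at most \<open>E d(Y\<^sup>u, Y\<^sup>v)\<^sup>p\<close>, an integral of \<open>d(f u, f v)\<^sup>p\<close> over the path law \<open>\<eta>\<close>, and
only the latter has to be estimated.

An absolutely continuous curve satisfies \<open>d(f u, f v) \<le> \<integral> |f'|\<close> over \<open>[u,v]\<close>
(\<open>mdist_le_integral_metric_speed\<close>). A weighted form of Jensen's inequality
(\<open>powr_le_weighted_integral\<close>) turns this into
\<open>d(f u, f v)\<^sup>p \<le> (\<integral> w)\<^sup>p\<^sup>-\<^sup>1 \<integral> |f'|\<^sup>p w\<^sup>1\<^sup>-\<^sup>p\<close> for every positive weight \<open>w\<close>, and integration against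
\<open>\<eta>\<close> replaces \<open>|f'|\<^sup>p(s)\<close> by \<open>K s = \<integral> |f'|\<^sup>p(s) \<eta>(df)\<close> (\<open>distance_moment_le\<close>). Two weights give the two
claims. With \<open>w = (1 + K)\<^sup>1\<^sup>/\<^sup>p\<close> the right-hand side is at most \<open>(\<integral> w)\<^sup>p\<close>, so \<open>w\<close> is an \<open>L\<^sup>p\<close> density
for the curve of processes. With \<open>w = 1\<close> the bound is \<open>|v - u|\<^sup>p\<^sup>-\<^sup>1 \<integral> K\<close> over \<open>[u,v]\<close>, and
Lebesgue differentiation (\<open>mean_le_value_near\<close>) bounds the metric derivative at almost every \<open>u\<close>.

Tonelli's theorem requires the metric speed to be jointly measurable in the curve and the time
(\<open>borel_measurable_metric_speed_joint\<close>). The two facts of real analysis behind the estimates, the Lebesgue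
differentiation theorem and the integration of a bound on difference quotients
(\<open>increment_le_integral_of_slope_bound\<close>), are both consequences of Henstock's lemma for the gauge
integral, the former together with Vitali's covering theorem.\<close>

section \<open>Two facts on integrals over intervals\<close>

text \<open>A mean value inequality with an exceptional null set \<open>N\<close>. A gauge is chosen so fine that on a piece of a
tagged division with tag \<open>x \<notin> N\<close> the increment of \<open>g\<close> is at most \<open>\<phi> x + e\<close> times its length. The
pieces with tag in \<open>N\<close> are controlled by absolute continuity: setting \<open>m\<close> to \<open>0\<close> on \<open>N\<close> changes no
integral, and Henstock's lemma then says that the integrals of \<open>m\<close> over these pieces are small in total.\<close>

lemma increment_le_integral_of_slope_bound:
  fixes g m \<phi> :: "real \<Rightarrow> real"
  assumes ab: "a \<le> b"
    and m: "m integrable_on {a..b}"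
    and incr: "\<And>x y. a \<le> x \<Longrightarrow> x \<le> y \<Longrightarrow> y \<le> b \<Longrightarrow> \<bar>g y - g x\<bar> \<le> integral {x..y} m"
    and \<phi>: "\<phi> integrable_on {a..b}"
    and N: "negligible N"
    and slope: "\<And>x e. x \<in> {a..b} - N \<Longrightarrow> 0 < e \<Longrightarrow>
      \<exists>d>0. \<forall>y\<in>{a..b}. \<bar>y - x\<bar> < d \<longrightarrow> \<bar>g y - g x\<bar> \<le> (\<phi> x + e) * \<bar>y - x\<bar>"
  shows "g b - g a \<le> integral {a..b} \<phi>"
proof (rule field_le_epsilon)
  fix \<epsilon> :: real assume \<epsilon>: "0 < \<epsilon>"
  define e where "e = \<epsilon> / (2 + (b - a))"
  have e: "0 < e" "2 * e + e * (b - a) = \<epsilon>"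
  proof -
    have pos: "0 < 2 + (b - a)" using ab by simp
    then show "0 < e" using \<epsilon> by (simp add: e_def)
    have "e * (2 + (b - a)) = \<epsilon>" unfolding e_def using pos by simp
    then show "2 * e + e * (b - a) = \<epsilon>" by (simp add: distrib_left mult.commute)
  qed
  \<comment> \<open>The Riemann summands of these modifications vanish at tags in \<open>N\<close>.\<close>
  define m' where "m' x = (if x \<in> N then 0 else m x)" for x
  define \<phi>' where "\<phi>' x = (if x \<in> N then 0 else \<phi> x)" for x
  have int: "m' integrable_on cbox a b" "\<phi>' integrable_on cbox a b"
    using integrable_spike[OF m N, of m'] integrable_spike[OF \<phi> N, of \<phi>']
    by (auto simp: m'_def \<phi>'_def)
  have eq: "integral K m' = integral K m" "integral K \<phi>' = integral K \<phi>" for K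
    by (auto intro!: integral_spike[OF N] simp: m'_def \<phi>'_def)
  obtain G1 where G1: "gauge G1" "\<And>p. \<lbrakk>p tagged_partial_division_of (cbox a b); G1 fine p\<rbrakk> \<Longrightarrow>
             (\<Sum>(x,k)\<in>p. norm(measure lborel k *\<^sub>R m' x - integral k m')) < e"
    using Henstock_lemma[OF int(1) e(1)] by blast
  obtain G2 where G2: "gauge G2" "\<And>p. \<lbrakk>p tagged_partial_division_of (cbox a b); G2 fine p\<rbrakk> \<Longrightarrow>
             (\<Sum>(x,k)\<in>p. norm(measure lborel k *\<^sub>R \<phi>' x - integral k \<phi>')) < e"
    using Henstock_lemma[OF int(2) e(1)] by blast
  have "\<exists>d>0. x \<in> {a..b} - N \<longrightarrow>
      (\<forall>y\<in>{a..b}. \<bar>y - x\<bar> < d \<longrightarrow> \<bar>g y - g x\<bar> \<le> (\<phi> x + e) * \<bar>y - x\<bar>)" for x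
    using slope[OF _ e(1), of x] by (cases "x \<in> {a..b} - N") (auto intro: exI[of _ 1])
  then obtain d where d: "\<And>x. 0 < d x" "\<And>x y. x \<in> {a..b} - N \<Longrightarrow> y \<in> {a..b} \<Longrightarrow> \<bar>y - x\<bar> < d x
      \<Longrightarrow> \<bar>g y - g x\<bar> \<le> (\<phi> x + e) * \<bar>y - x\<bar>"
    by metis
  have "gauge (\<lambda>x. G1 x \<inter> (G2 x \<inter> ball x (d x)))"
    using G1(1) G2(1) d(1) by (intro gauge_Int gauge_ball_dependent) auto
  then obtain p where p: "p tagged_division_of {a..b}" "(\<lambda>x. G1 x \<inter> (G2 x \<inter> ball x (d x))) fine p"
    using fine_division_exists_real by blast
  have fine: "G1 fine p" "G2 fine p" "(\<lambda>x. ball x (d x)) fine p"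
    using p(2) by (auto simp: fine_def)
  have part: "p tagged_partial_division_of (cbox a b)"
    using p(1) by (auto simp: tagged_division_of_def)
  have "g b - g a = (\<Sum>(x,K)\<in>p. g (Sup K) - g (Inf K))"
    by (rule additive_tagged_division_1[OF ab p(1), symmetric])
  also have "\<dots> \<le> (\<Sum>(x,K)\<in>p. norm (measure lborel K *\<^sub>R m' x - integral K m')
      + norm (measure lborel K *\<^sub>R \<phi>' x - integral K \<phi>') + (integral K \<phi>' + e * measure lborel K))"
  proof (intro sum_mono, clarify)
    fix x K assume xK: "(x, K) \<in> p"
    obtain l r where K: "K = {l..r}" "x \<in> {l..r}"
      using tagged_division_ofD(2,4)[OF p(1) xK] by (auto simp: box_real)
    have sub: "{l..r} \<subseteq> {a..b}" "a \<le> x" "x \<le> b"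
      using tagged_division_ofD(3)[OF p(1) xK] K by auto
    have lr: "l \<le> x" "x \<le> r" "a \<le> l" "r \<le> b" using K(2) sub by auto
    show "g (Sup K) - g (Inf K) \<le> norm (measure lborel K *\<^sub>R m' x - integral K m')
      + norm (measure lborel K *\<^sub>R \<phi>' x - integral K \<phi>') + (integral K \<phi>' + e * measure lborel K)"
    proof (cases "x \<in> N")
      case True
      have "g r - g l \<le> integral {l..r} m"
        using incr[of l r] lr by auto
      moreover have "0 \<le> e * measure lborel K" using e(1) by simp
      ultimately show ?thesis using True lr K(1) 
        by (simp add: m'_def[of x] \<phi>'_def[of x] eq) 
    next
      case False
      have "{l..r} \<subseteq> ball x (d x)"
        using fineD[OF fine(3) xK] K(1) by auto
      moreover have "l \<in> {l..r}" "r \<in> {l..r}" using lr by auto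
      ultimately have "l \<in> ball x (d x)" "r \<in> ball x (d x)" by blast+
      then have "\<bar>g l - g x\<bar> \<le> (\<phi> x + e) * \<bar>l - x\<bar>" "\<bar>g r - g x\<bar> \<le> (\<phi> x + e) * \<bar>r - x\<bar>"
        using d(2)[of x l] d(2)[of x r] lr False sub by (auto simp: dist_real_def)
      then have "g r - g l \<le> (\<phi> x + e) * (r - x) + (\<phi> x + e) * (x - l)"
        using lr by (simp add: abs_if split: if_splits)
      also have "\<dots> = measure lborel K *\<^sub>R \<phi>' x + e * measure lborel K"
        using lr False K(1) by (simp add: \<phi>'_def algebra_simps)
      finally show ?thesis using lr K(1) by (simp add: abs_if)
    qed
  qed
  also have "\<dots> = (\<Sum>(x,k)\<in>p. norm(measure lborel k *\<^sub>R m' x - integral k m'))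
      + (\<Sum>(x,k)\<in>p. norm(measure lborel k *\<^sub>R \<phi>' x - integral k \<phi>'))
      + ((\<Sum>(x,k)\<in>p. integral k \<phi>') + e * (\<Sum>(x,k)\<in>p. measure lborel k))"
    by (simp add: sum.distrib split_def sum_distrib_left)
  also have "(\<Sum>(x,k)\<in>p. integral k \<phi>') = integral {a..b} \<phi>"
    using integral_combine_tagged_division_topdown[OF int(2), of p] p(1) eq(2) by simp
  also have "(\<Sum>(x,k)\<in>p. measure lborel k) = b - a"
    using additive_content_tagged_division[of p a b] p(1) ab by simp
  finally show "g b - g a \<le> integral {a..b} \<phi> + \<epsilon>"
    using G1(2)[OF part fine(1)] G2(2)[OF part fine(2)] e(2) by linarith
qed

text \<open>The upper half of the Lebesgue differentiation theorem. Around every point of the bad set there are arbitrarily short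
intervals on which the integral of \<open>h\<close> exceeds the Riemann summand by \<open>c\<close> times the length. Vitali's
theorem extracts disjoint ones that cover almost all of the bad set, and by Henstock's lemma the excess, and
with it the total length, is as small as desired.\<close>

lemma mean_le_value_near:
  fixes h :: "real \<Rightarrow> real"
  assumes h: "h integrable_on {a..b}"
  obtains N where "negligible N"
    "\<And>x c. x \<in> {a..b} - N \<Longrightarrow> 0 < c \<Longrightarrow> \<exists>d>0. \<forall>y\<in>{a..b}. \<bar>y - x\<bar> < d \<longrightarrow>
      integral {min x y..max x y} h \<le> (h x + c) * \<bar>y - x\<bar>"
proof -
  define E where "E c = {x\<in>{a..b}. \<forall>d>0. \<exists>y\<in>{a..b}. \<bar>y - x\<bar> < d \<and>
      (h x + c) * \<bar>y - x\<bar> < integral {min x y..max x y} h}" for c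
  have E: "negligible (E c)" if c: "0 < c" for c
    unfolding negligible_outer_le
  proof (intro allI impI)
    fix \<epsilon> :: real assume \<epsilon>: "0 < \<epsilon>"
    obtain G where G: "gauge G" "\<And>p. \<lbrakk>p tagged_partial_division_of (cbox a b); G fine p\<rbrakk> \<Longrightarrow>
             (\<Sum>(x,k)\<in>p. norm(measure lborel k *\<^sub>R h x - integral k h)) < c * \<epsilon>"
      using Henstock_lemma[of h a b "c * \<epsilon>"] h c \<epsilon> by auto
    \<comment> \<open>The pair \<open>(x, y)\<close> stands for the interval between \<open>x\<close> and \<open>y\<close>, tagged by its end point \<open>x\<close>.\<close>
    define J where "J z = {min (fst z) (snd z)..max (fst z) (snd z)}" for z :: "real \<times> real"
    define V where "V = {z. fst z \<in> E c \<and> snd z \<in> {a..b} \<and> snd z \<noteq> fst z \<and> J z \<subseteq> G (fst z) \<and>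
      (h (fst z) + c) * \<bar>snd z - fst z\<bar> < integral (J z) h}"
    have J: "cball ((fst z + snd z) / 2) (\<bar>snd z - fst z\<bar> / 2) = J z" for z
    proof (intro set_eqI)
      fix x show "x \<in> cball ((fst z + snd z) / 2) (\<bar>snd z - fst z\<bar> / 2) \<longleftrightarrow> x \<in> J z"
        unfolding mem_cball dist_real_def J_def atLeastAtMost_iff
        by (auto simp: abs_if min_def max_def field_simps split: if_splits)
    qed
    obtain C where C: "countable C" "C \<subseteq> V" "pairwise (\<lambda>i j. disjnt (J i) (J j)) C"
      "negligible (E c - (\<Union>i\<in>C. J i))"
    proof (rule Vitali_covering_theorem_cballs[of V "\<lambda>z. \<bar>snd z - fst z\<bar> / 2" "E c" "\<lambda>z. (fst z + snd z) / 2"])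
      show "0 < \<bar>snd z - fst z\<bar> / 2" if "z \<in> V" for z using that by (auto simp: V_def)
    next
      fix x d :: real assume x: "x \<in> E c" and d: "0 < d"
      obtain r where r: "0 < r" "ball x r \<subseteq> G x"
        using G(1) by (metis gauge_def openE)
      obtain y where y: "y \<in> {a..b}" "\<bar>y - x\<bar> < min r d"
          "(h x + c) * \<bar>y - x\<bar> < integral {min x y..max x y} h"
        using x d r(1) unfolding E_def by (auto dest!: spec[of _ "min r d"])
      have "y \<noteq> x" using y(3) by auto
      moreover have "J (x, y) \<subseteq> ball x r" using y(2) by (auto simp: J_def dist_real_def)
      ultimately have "(x, y) \<in> V" using x y r by (auto simp: V_def J_def)
      moreover have "x \<in> J (x, y)" by (auto simp: J_def)
      ultimately show "\<exists>z. z \<in> V \<and> x \<in> cball ((fst z + snd z) / 2) (\<bar>snd z - fst z\<bar> / 2)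
          \<and> \<bar>snd z - fst z\<bar> / 2 < d"
        unfolding J using y(2) d by (intro exI[of _ "(x, y)"]) auto
    qed (simp_all add: J)
    have fin: "measure lebesgue (\<Union>i\<in>D. J i) \<le> \<epsilon>" if D: "D \<subseteq> C" "finite D" for D
    proof -
      let ?p = "(\<lambda>z. (fst z, J z)) ` D"
      have DV: "D \<subseteq> V" using D C(2) by blast
      have nz: "J i \<noteq> {}" for i by (auto simp: J_def)
      have inj: "inj_on (\<lambda>z. (fst z, J z)) D"
      proof (rule inj_onI)
        fix i j assume ij: "i \<in> D" "j \<in> D" "(fst i, J i) = (fst j, J j)"
        show "i = j"
        proof (rule ccontr)
          assume "i \<noteq> j"
          then have "disjnt (J i) (J j)" using pairwiseD[OF C(3), of i j] ij D(1) by blast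
          then show False using ij(3) nz by (auto simp: disjnt_def)
        qed
      qed
      have "?p tagged_partial_division_of (cbox a b)"
        unfolding tagged_partial_division_of_def
      proof (intro conjI allI impI)
        show "finite ?p" using D by simp
      next
        fix x K assume "(x, K) \<in> ?p"
        then obtain z where z: "z \<in> D" "x = fst z" "K = J z" by auto
        show "x \<in> K" using z by (auto simp: J_def)
        show "\<exists>a b. K = cbox a b" using z by (auto simp: J_def)
        have "fst z \<in> {a..b}" "snd z \<in> {a..b}" using z(1) DV by (auto simp: V_def E_def)
        then show "K \<subseteq> cbox a b" using z by (auto simp: J_def)
      next
        fix x1 K1 x2 K2 assume *: "(x1, K1) \<in> ?p \<and> (x2, K2) \<in> ?p \<and> (x1, K1) \<noteq> (x2, K2)"
        then obtain i j where ij: "i \<in> D" "j \<in> D" "K1 = J i" "K2 = J j" "i \<noteq> j" by auto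
        then have "disjnt K1 K2" using pairwiseD[OF C(3), of i j] D(1) by blast
        then show "interior K1 \<inter> interior K2 = {}"
          using interior_subset[of K1] interior_subset[of K2] by (auto simp: disjnt_def)
      qed
      moreover have "G fine ?p" using DV by (auto simp: fine_def V_def)
      ultimately have "(\<Sum>(x,k)\<in>?p. norm(measure lborel k *\<^sub>R h x - integral k h)) < c * \<epsilon>"
        by (rule G(2))
      then have lt: "(\<Sum>z\<in>D. \<bar>measure lborel (J z) * h (fst z) - integral (J z) h\<bar>) < c * \<epsilon>"
        by (subst (asm) sum.reindex[OF inj]) simp
      have cont: "measure lborel (J z) = \<bar>snd z - fst z\<bar>" for z
        by (cases "fst z \<le> snd z") (simp_all add: J_def)
      have "c * measure lborel (J z) \<le> \<bar>measure lborel (J z) * h (fst z) - integral (J z) h\<bar>" if "z \<in> D" for z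
      proof -
        have "(h (fst z) + c) * measure lborel (J z) < integral (J z) h"
          using that DV by (auto simp: V_def cont)
        then show ?thesis by (simp add: algebra_simps)
      qed
      then have "c * (\<Sum>z\<in>D. measure lborel (J z)) \<le> (\<Sum>z\<in>D. \<bar>measure lborel (J z) * h (fst z) - integral (J z) h\<bar>)"
        unfolding sum_distrib_left by (rule sum_mono)
      then have "c * (\<Sum>z\<in>D. measure lborel (J z)) < c * \<epsilon>" using lt by linarith
      then have le: "(\<Sum>z\<in>D. measure lborel (J z)) < \<epsilon>" using c by simp
      have "measure lebesgue (\<Union>i\<in>D. J i) \<le> (\<Sum>z\<in>D. measure lebesgue (J z))"
        using D by (intro measure_UNION_le) (auto simp: J_def)
      also have "\<dots> = (\<Sum>z\<in>D. measure lborel (J z))"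
        by (simp add: J_def measure_completion)
      finally show ?thesis using le by simp
    qed
    have UC: "(\<Union>i\<in>C. J i) \<in> lmeasurable \<and> measure lebesgue (\<Union>i\<in>C. J i) \<le> \<epsilon>"
    proof -
      have J_meas: "J i \<in> lmeasurable" for i by (auto simp: J_def)
      show ?thesis
        using fmeasurable_UN_bound[OF C(1), of J lebesgue \<epsilon>] measure_UN_bound[OF C(1), of J lebesgue \<epsilon>] fin
          J_meas by auto
    qed
    have ng: "E c - (\<Union>i\<in>C. J i) \<in> lmeasurable" "measure lebesgue (E c - (\<Union>i\<in>C. J i)) = 0"
      using C(4) by (auto simp: negligible_iff_measure)
    show "\<exists>T. E c \<subseteq> T \<and> T \<in> lmeasurable \<and> measure lebesgue T \<le> \<epsilon>"
    proof (intro exI[of _ "(\<Union>i\<in>C. J i) \<union> (E c - (\<Union>i\<in>C. J i))"] conjI)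
      show "measure lebesgue ((\<Union>i\<in>C. J i) \<union> (E c - (\<Union>i\<in>C. J i))) \<le> \<epsilon>"
        using measure_Un_le[of "\<Union>i\<in>C. J i" lebesgue "E c - (\<Union>i\<in>C. J i)"] UC ng by auto
      show "(\<Union>i\<in>C. J i) \<union> (E c - (\<Union>i\<in>C. J i)) \<in> lmeasurable"
        using UC ng by (intro fmeasurable.Un) auto
    qed auto
  qed
  define \<delta> where "\<delta> n = inverse (real (Suc n))" for n
  show ?thesis
  proof (rule that)
    show "negligible (\<Union>(range (\<lambda>n. E (\<delta> n))))"
      using E by (intro negligible_countable_Union) (auto simp: \<delta>_def)
  next
    fix x c :: real assume x: "x \<in> {a..b} - \<Union>(range (\<lambda>n. E (\<delta> n)))" and c: "0 < c"
    obtain n where n: "\<delta> n < c"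
      using reals_Archimedean[OF c] unfolding \<delta>_def by blast
    have "x \<notin> E (\<delta> n)" "x \<in> {a..b}" using x by auto
    then have "\<not> (\<forall>d>0. \<exists>y\<in>{a..b}. \<bar>y - x\<bar> < d \<and>
      (h x + \<delta> n) * \<bar>y - x\<bar> < integral {min x y..max x y} h)"
      unfolding E_def mem_Collect_eq by blast
    then obtain d where d: "0 < d" "\<And>y. y \<in> {a..b} \<Longrightarrow> \<bar>y - x\<bar> < d \<Longrightarrow>
        integral {min x y..max x y} h \<le> (h x + \<delta> n) * \<bar>y - x\<bar>"
      by (meson not_less)
    have "integral {min x y..max x y} h \<le> (h x + c) * \<bar>y - x\<bar>" if "y \<in> {a..b}" "\<bar>y - x\<bar> < d" for y
    proof -
      have "integral {min x y..max x y} h \<le> (h x + \<delta> n) * \<bar>y - x\<bar>"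
        using d(2)[OF that] .
      also have "\<dots> \<le> (h x + c) * \<bar>y - x\<bar>"
        using n by (intro mult_right_mono) auto
      finally show ?thesis .
    qed
    then show "\<exists>d>0. \<forall>y\<in>{a..b}. \<bar>y - x\<bar> < d \<longrightarrow>
        integral {min x y..max x y} h \<le> (h x + c) * \<bar>y - x\<bar>"
      using d(1) by blast
  qed
qed

section \<open>Weighted Jensen inequality\<close>

lemma borel_measurable_ennreal_powr [measurable]:
  assumes [measurable]: "f \<in> borel_measurable M"
  shows "(\<lambda>x. ennreal_powr (f x) r) \<in> borel_measurable M"
  unfolding ennreal_powr_def by measurable

lemma ennreal_powr_ennreal: "0 \<le> x \<Longrightarrow> ennreal_powr (ennreal x) r = ennreal (x powr r)"
  by (simp add: ennreal_powr_def)

lemma ennreal_powr_mono: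
  assumes "x \<le> y" "0 \<le> r" shows "ennreal_powr x r \<le> ennreal_powr y r"
proof (cases "y = \<top>")
  case False
  then have "x \<noteq> \<top>" using assms(1) by (auto simp: top_unique)
  then show ?thesis using assms False
    by (auto simp: ennreal_powr_def less_top intro!: ennreal_leI powr_mono2 enn2real_mono)
qed (simp add: ennreal_powr_def)

text \<open>The graph of \<open>x powr p\<close> lies above its tangent at \<open>c\<close>; in this form every term is nonnegative, so that
it can be integrated in \<^typ>\<open>ennreal\<close>.\<close>

lemma powr_tangent:
  fixes p c x :: real
  assumes p: "1 \<le> p" and c: "0 \<le> c" and x: "0 \<le> x"
  shows "p * c powr (p - 1) * x \<le> x powr p + (p - 1) * c powr p"
proof (cases "c = 0 \<or> x = 0")
  case True then show ?thesis using p by auto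
next
  case False
  then have pos: "0 < c" "0 < x" using c x by auto
  have "x powr p - c powr p \<ge> (p * c powr (p - 1)) * (x - c)"
    using pos powr_convex[OF p]
    by (intro convex_on_imp_above_tangent[of "{0<..}"])
       (auto simp: interior_open intro!: has_field_derivative_at_within has_real_derivative_powr)
  moreover have "(p * c powr (p - 1)) * (x - c) = p * c powr (p - 1) * x - p * c powr p"
    using pos by (simp add: powr_diff right_diff_distrib)
  ultimately show ?thesis by (simp add: left_diff_distrib)
qed

text \<open>Jensen's inequality for \<open>g / w\<close> and the measure with density \<open>w / A\<close>. The tangent at
\<open>c = d / A\<close> is integrated in \<^typ>\<open>ennreal\<close>, where \<open>g\<close> may take the value \<open>\<infinity>\<close> and may have
an infinite integral.\<close>

lemma powr_le_weighted_integral: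
  fixes g :: "'b \<Rightarrow> ennreal" and w :: "'b \<Rightarrow> real"
  assumes p: "1 \<le> p" and [measurable]: "g \<in> borel_measurable M" "w \<in> borel_measurable M"
    and w: "\<And>x. 0 < w x" and A: "(\<integral>\<^sup>+x. ennreal (w x) \<partial>M) = ennreal A" "0 < A"
    and d: "0 \<le> d" "ennreal d \<le> (\<integral>\<^sup>+x. g x \<partial>M)"
  shows "ennreal (d powr p) \<le>
    ennreal (A powr (p - 1)) * (\<integral>\<^sup>+x. ennreal_powr (g x) p * ennreal (w x powr (1 - p)) \<partial>M)"
proof (cases "(\<integral>\<^sup>+x. ennreal_powr (g x) p * ennreal (w x powr (1 - p)) \<partial>M)")
  case (real r)
  define c where "c = d / A"
  have c: "0 \<le> c" using d A by (simp add: c_def)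
  have pointwise: "ennreal (p * c powr (p - 1)) * g x \<le>
      ennreal_powr (g x) p * ennreal (w x powr (1 - p)) + ennreal ((p - 1) * c powr p) * ennreal (w x)" for x
  proof (cases "g x")
    case top
    have "w x powr (1 - p) \<noteq> 0" using w[of x] by simp
    then show ?thesis using top by (simp add: ennreal_powr_def ennreal_top_mult)
  next
    case (real y)
    have wx: "w x > 0" by fact
    have "w x * (p * c powr (p - 1) * (y / w x)) \<le> w x * ((y / w x) powr p + (p - 1) * c powr p)"
      using wx real by (intro mult_left_mono powr_tangent p c) auto
    also have "w x * ((y / w x) powr p + (p - 1) * c powr p) = y powr p * (w x powr (1 - p)) + (p - 1) * c powr p * w x"
      using wx real by (simp add: powr_divide powr_diff field_simps)
    finally have "p * c powr (p - 1) * y \<le> y powr p * (w x powr (1 - p)) + (p - 1) * c powr p * w x"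
      using wx by simp
    then show ?thesis using real p wx
      by (simp add: ennreal_powr_ennreal flip: ennreal_mult ennreal_plus) 
  qed
  have "ennreal (p * c powr (p - 1)) * ennreal d \<le> ennreal (p * c powr (p - 1)) * (\<integral>\<^sup>+x. g x \<partial>M)"
    using d(2) by (rule mult_left_mono) simp
  also have "\<dots> = (\<integral>\<^sup>+x. ennreal (p * c powr (p - 1)) * g x \<partial>M)"
    by (simp add: nn_integral_cmult)
  also have "\<dots> \<le> (\<integral>\<^sup>+x. ennreal_powr (g x) p * ennreal (w x powr (1 - p))
      + ennreal ((p - 1) * c powr p) * ennreal (w x) \<partial>M)"
    by (intro nn_integral_mono pointwise)
  also have "\<dots> = ennreal r + ennreal ((p - 1) * c powr p) * ennreal A"
    by (simp add: nn_integral_add nn_integral_cmult real A)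
  finally have "p * c powr (p - 1) * d \<le> r + (p - 1) * c powr p * A"
    using p d A(2) real by (simp flip: ennreal_mult ennreal_plus)
  moreover have "c powr (p - 1) * d = c powr p * A"
    using d A by (cases "d = 0") (auto simp: c_def powr_diff)
  then have "p * c powr (p - 1) * d = p * (c powr p * A)" by (simp only: mult.assoc)
  moreover have "(p - 1) * c powr p * A = p * (c powr p * A) - c powr p * A"
    by (simp add: left_diff_distrib)
  ultimately have "c powr p * A \<le> r" by linarith
  then have "A powr (p - 1) * (c powr p * A) \<le> A powr (p - 1) * r" by (intro mult_left_mono) auto
  moreover have "A powr (p - 1) * (c powr p * A) = d powr p"
    using A d by (simp add: c_def powr_diff powr_divide)
  ultimately show ?thesis using real by (simp flip: ennreal_mult)
next
  case top
  then show ?thesis using A(2) by (simp add: ennreal_mult_top)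
qed

section \<open>The diagonal coupling\<close>

text \<open>For a function that need not be measurable, \<^const>\<open>nn_integral\<close> is a lower integral and may decrease
under a push-forward, since fewer simple functions are then available below \<open>f\<close>.\<close>

lemma nn_integral_distr_le:
  assumes [measurable]: "h \<in> measurable M N"
  shows "(\<integral>\<^sup>+x. f x \<partial>distr M N h) \<le> (\<integral>\<^sup>+x. f (h x) \<partial>M)"
proof -
  have "integral\<^sup>S (distr M N h) g \<le> (\<integral>\<^sup>+x. f (h x) \<partial>M)" if g: "simple_function (distr M N h) g" "g \<le> f" for g
  proof -
    have "integral\<^sup>S (distr M N h) g = (\<integral>\<^sup>+x. g x \<partial>distr M N h)"
      using g(1) by (simp add: nn_integral_eq_simple_integral)
    also have "\<dots> = (\<integral>\<^sup>+x. g (h x) \<partial>M)"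
      using borel_measurable_simple_function[OF g(1)] by (simp add: nn_integral_distr)
    also have "\<dots> \<le> (\<integral>\<^sup>+x. f (h x) \<partial>M)"
      using g(2) by (intro nn_integral_mono) (simp add: le_fun_def)
    finally show ?thesis .
  qed
  then show ?thesis unfolding nn_integral_def[of "distr M N h"] by (auto intro!: SUP_least)
qed

text \<open>If the events of \<open>H\<close> already belong to \<open>K\<close> up to null sets, their indicators can be pulled out of the
conditional expectation given \<open>K\<close>.\<close>

lemma cond_indepI_AE_eq:
  assumes M: "prob_space M" and sub: "subalgebra M G" "subalgebra M H" "subalgebra M K"
    and eq: "\<And>b. b \<in> sets H \<Longrightarrow> \<exists>b'\<in>sets K. AE x in M. x \<in> b \<longleftrightarrow> x \<in> b'"
  shows "cond_indep M G H K"
  unfolding cond_indep_def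
proof (intro ballI)
  fix a b assume a: "a \<in> sets G" and b: "b \<in> sets H"
  interpret prob_space M by fact
  interpret finite_measure_subalgebra M K by unfold_locales fact
  obtain b' where b': "b' \<in> sets K" "AE x in M. x \<in> b \<longleftrightarrow> x \<in> b'"
    using eq[OF b] by blast
  have [measurable]: "a \<in> sets M" "b \<in> sets M" "b' \<in> sets M"
    using a b b' sub by (auto simp: subalgebra_def)
  have [measurable]: "(indicator b' :: 'a \<Rightarrow> real) \<in> borel_measurable K"
    using b' by simp
  have "AE x in M. real_cond_exp M K (indicator (a \<inter> b)) x
      = real_cond_exp M K (\<lambda>x. indicator b' x * indicator a x) x"
    using b'(2) by (intro real_cond_exp_cong) (auto elim!: eventually_mono simp: indicator_def)
  moreover have "AE x in M. real_cond_exp M K (\<lambda>x. indicator b' x * indicator a x) x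
      = indicator b' x * real_cond_exp M K (indicator a) x"
    by (intro real_cond_exp_mult)
       (auto intro!: integrable_const_bound[of _ 1] split: split_indicator)
  moreover have "AE x in M. real_cond_exp M K (indicator b) x = real_cond_exp M K (indicator b') x"
    using b'(2) by (intro real_cond_exp_cong) (auto elim!: eventually_mono simp: indicator_def)
  moreover have "AE x in M. real_cond_exp M K (indicator b') x = indicator b' x"
    by (intro real_cond_exp_F_meas) (auto intro!: integrable_const_bound[of _ 1] split: split_indicator)
  ultimately show "AE x in M. real_cond_exp M K (indicator (a \<inter> b)) x
      = real_cond_exp M K (indicator a) x * real_cond_exp M K (indicator b) x"
    by eventually_elim (simp add: mult.commute)
qed

lemma subalgebra_pair:
  assumes "subalgebra P G" "subalgebra Q H"
  shows "subalgebra (P \<Otimes>\<^sub>M Q) (G \<Otimes>\<^sub>M H)"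
proof -
  have "sets (G \<Otimes>\<^sub>M H) \<subseteq> sets (P \<Otimes>\<^sub>M Q)"
    unfolding sets_pair_measure[of G H]
    using assms by (intro sets.sigma_sets_subset') (auto simp: subalgebra_def space_pair_measure)
  then show ?thesis using assms by (simp add: subalgebra_def space_pair_measure)
qed

lemma subalgebra_filt0:
  assumes "filtered_prob_space T P F" "t \<le> T"
  shows "subalgebra P (filt0 \<lparr>prob_of = P, filt = F, proc = Y\<rparr> t)"
proof (cases "t = 0")
  case True
  have "sigma_sets (space P) {} \<subseteq> sets P"
    by (intro sets.sigma_sets_subset) simp
  then show ?thesis using True by (simp add: filt0_def subalgebra_def)
next
  case False
  then show ?thesis using assms by (simp add: filt0_def filtered_prob_space_def)
qed

text \<open>On the diagonal an event \<open>b\<close> of a product \<open>\<sigma>\<close>-algebra coincides with the cylinder over its diagonal section,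
and this cylinder can be placed in whichever coordinate has the larger \<open>\<sigma>\<close>-algebra.\<close>

lemma diagonal_sets_transfer:
  assumes P: "subalgebra P G" "subalgebra P I" "subalgebra P G'" "subalgebra P I'"
    and b: "b \<in> sets (G \<Otimes>\<^sub>M I)"
    and sub: "(sets G \<subseteq> sets G' \<and> sets I \<subseteq> sets G') \<or> (sets G \<subseteq> sets I' \<and> sets I \<subseteq> sets I')"
  shows "\<exists>b'\<in>sets (G' \<Otimes>\<^sub>M I'). AE x in distr P (P \<Otimes>\<^sub>M P) (\<lambda>\<omega>. (\<omega>, \<omega>)). x \<in> b \<longleftrightarrow> x \<in> b'"
proof -
  define B where "B = {\<omega>\<in>space P. (\<omega>, \<omega>) \<in> b}"
  have sp: "space G = space P" "space I = space P" "space G' = space P" "space I' = space P"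
    using P by (auto simp: subalgebra_def)
  have ids: "(\<lambda>\<omega>. (\<omega>, \<omega>)) \<in> measurable Q (G \<Otimes>\<^sub>M I)"
    if "sets G \<subseteq> sets Q" "sets I \<subseteq> sets Q" "space Q = space P" for Q
    using that sp by (intro measurable_Pair) (auto simp: measurable_def Int_absorb2 dest: sets.sets_into_space)
  have B: "B \<in> sets Q" if "sets G \<subseteq> sets Q" "sets I \<subseteq> sets Q" "space Q = space P" for Q
    using measurable_sets[OF ids[OF that] b] that(3) by (simp add: B_def vimage_def Int_def conj_commute)
  have bP: "b \<in> sets (P \<Otimes>\<^sub>M P)"
    using b subalgebra_pair[OF P(1,2)] by (auto simp: subalgebra_def)
  have *: "\<exists>b'\<in>sets (G' \<Otimes>\<^sub>M I'). \<forall>\<omega>\<in>space P. (\<omega>, \<omega>) \<in> b \<longleftrightarrow> (\<omega>, \<omega>) \<in> b'"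
    using sub
  proof
    assume "sets G \<subseteq> sets G' \<and> sets I \<subseteq> sets G'"
    then have "B \<times> space I' \<in> sets (G' \<Otimes>\<^sub>M I')"
      using sp by (intro pair_measureI sets.top B) auto
    then show ?thesis using sp by (intro bexI[of _ "B \<times> space I'"]) (auto simp: B_def)
  next
    assume "sets G \<subseteq> sets I' \<and> sets I \<subseteq> sets I'"
    then have "space G' \<times> B \<in> sets (G' \<Otimes>\<^sub>M I')"
      using sp by (intro pair_measureI sets.top B) auto
    then show ?thesis using sp by (intro bexI[of _ "space G' \<times> B"]) (auto simp: B_def)
  qed
  then obtain b' where b': "b' \<in> sets (G' \<Otimes>\<^sub>M I')" "\<And>\<omega>. \<omega> \<in> space P \<Longrightarrow> (\<omega>, \<omega>) \<in> b \<longleftrightarrow> (\<omega>, \<omega>) \<in> b'"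
    by blast
  have b'P: "b' \<in> sets (P \<Otimes>\<^sub>M P)"
    using b'(1) subalgebra_pair[OF P(3,4)] by (auto simp: subalgebra_def)
  have [measurable]: "Measurable.pred (P \<Otimes>\<^sub>M P) (\<lambda>x. x \<in> b \<longleftrightarrow> x \<in> b')"
    using bP b'P by measurable
  have "AE x in distr P (P \<Otimes>\<^sub>M P) (\<lambda>\<omega>. (\<omega>, \<omega>)). x \<in> b \<longleftrightarrow> x \<in> b'"
    by (subst AE_distr_iff) (use b'(2) in \<open>auto intro!: measurable_Pair AE_I2\<close>)
  then show ?thesis using b'(1) by blast
qed

lemma diagonal_coupling_bicausal:
  assumes F: "filtered_prob_space T P F"
  shows "distr P (P \<Otimes>\<^sub>M P) (\<lambda>\<omega>. (\<omega>, \<omega>)) \<in>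
    bicausal_couplings T \<lparr>prob_of = P, filt = F, proc = Y\<rparr> \<lparr>prob_of = P, filt = F, proc = Y'\<rparr>"
proof -
  let ?\<pi> = "distr P (P \<Otimes>\<^sub>M P) (\<lambda>\<omega>. (\<omega>, \<omega>))"
  let ?A = "\<lparr>prob_of = P, filt = F, proc = Y\<rparr>" and ?B = "\<lparr>prob_of = P, filt = F, proc = Y'\<rparr>"
  interpret prob_space P using F by (simp add: filtered_prob_space_def)
  have AB: "filt0 ?B = filt0 ?A" by (simp add: filt0_def fun_eq_iff)
  have pi: "prob_space ?\<pi>" by (intro prob_space_distr) measurable
  have coup: "?\<pi> \<in> couplings P P"
    using pi by (simp add: couplings_def distr_distr comp_def distr_id)
  have sub: "subalgebra P (filt0 ?A t)" if "t \<le> T" for t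
    using subalgebra_filt0[OF F that] .
  have subpi: "subalgebra ?\<pi> (filt0 ?A s \<Otimes>\<^sub>M filt0 ?A t)" if "s \<le> T" "t \<le> T" for s t
    using subalgebra_pair[OF sub[OF that(1)] sub[OF that(2)]] by (simp add: subalgebra_def space_pair_measure)
  have triv: "sets (filt0 ?A 0) \<subseteq> sets (filt0 ?A t)" if "t \<le> T" for t
  proof -
    have "sigma_sets (space P) {} \<subseteq> sets (filt0 ?A t)"
      using sub[OF that] sets.sigma_sets_subset[of "{}" "filt0 ?A t"] by (simp add: subalgebra_def)
    then show ?thesis by (simp add: filt0_def)
  qed
  have "cond_indep ?\<pi> (filt0 ?A T \<Otimes>\<^sub>M filt0 ?A 0) (filt0 ?A 0 \<Otimes>\<^sub>M filt0 ?A t) (filt0 ?A t \<Otimes>\<^sub>M filt0 ?A 0) \<and>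
     cond_indep ?\<pi> (filt0 ?A 0 \<Otimes>\<^sub>M filt0 ?A T) (filt0 ?A t \<Otimes>\<^sub>M filt0 ?A 0) (filt0 ?A 0 \<Otimes>\<^sub>M filt0 ?A t)"
    if "t \<in> {1..T - 1}" for t
  proof -
    have t: "t \<le> T" using that by auto
    have transfer: "\<exists>b'\<in>sets (filt0 ?A k \<Otimes>\<^sub>M filt0 ?A l). AE x in ?\<pi>. x \<in> b \<longleftrightarrow> x \<in> b'"
      if "b \<in> sets (filt0 ?A i \<Otimes>\<^sub>M filt0 ?A j)" "(i, j) \<in> {(0, t), (t, 0)}" "(k, l) \<in> {(0, t), (t, 0)}" for b i j k l
      by (rule diagonal_sets_transfer[OF sub sub sub sub that(1)]) (use that t triv[OF t] in auto)
    show ?thesis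
      by (intro conjI cond_indepI_AE_eq pi subpi) (use t in \<open>auto intro: transfer\<close>)
  qed
  then show ?thesis using coup unfolding bicausal_couplings_def by (simp add: AB)
qed

lemma AW_le_diagonal_cost:
  assumes p: "1 \<le> p" and F: "filtered_prob_space T P F"
  shows "AW p T X \<lparr>prob_of = P, filt = F, proc = Y\<rparr> \<lparr>prob_of = P, filt = F, proc = Y'\<rparr> \<le>
    ennreal_powr (\<integral>\<^sup>+\<omega>. ennreal (mdist (path_space p T X) (Y \<omega>) (Y' \<omega>) powr p) \<partial>P) (1 / p)"
  unfolding AW_def
proof (rule INF_lower2[OF diagonal_coupling_bicausal[OF F]], rule ennreal_powr_mono)
  show "(\<integral>\<^sup>+ (\<omega>, \<omega>'). ennreal (mdist (path_space p T X)
      (proc \<lparr>prob_of = P, filt = F, proc = Y\<rparr> \<omega>)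
      (proc \<lparr>prob_of = P, filt = F, proc = Y'\<rparr> \<omega>') powr p) \<partial>distr P (P \<Otimes>\<^sub>M P) (\<lambda>\<omega>. (\<omega>, \<omega>)))
    \<le> (\<integral>\<^sup>+\<omega>. ennreal (mdist (path_space p T X) (Y \<omega>) (Y' \<omega>) powr p) \<partial>P)"
    by (rule order_trans[OF nn_integral_distr_le]) auto
qed (use p in simp)

section \<open>Measurability of the metric speed\<close>

lemma openin_mtopology_of_Pow: "{U. openin (mtopology_of m) U} \<subseteq> Pow (mspace m)"
  using openin_subset[of "mtopology_of m"] by fastforce

lemma space_borel_of_metric [simp]: "space (borel_of_metric m) = mspace m"
  unfolding borel_of_metric_def by (rule space_measure_of[OF openin_mtopology_of_Pow])

lemma borel_measurable_borel_of_metric: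
  fixes f :: "'a \<Rightarrow> 'b::topological_space"
  assumes "continuous_map (mtopology_of m) euclidean f"
  shows "f \<in> borel_measurable (borel_of_metric m)"
proof (rule borel_measurableI)
  fix S :: "'b set" assume "open S"
  then have "openin (mtopology_of m) {x \<in> topspace (mtopology_of m). f x \<in> S}"
    by (intro openin_continuous_map_preimage[OF assms]) simp
  moreover have "{x \<in> topspace (mtopology_of m). f x \<in> S} = f -` S \<inter> space (borel_of_metric m)"
    by auto
  ultimately show "f -` S \<inter> space (borel_of_metric m) \<in> sets (borel_of_metric m)"
    unfolding borel_of_metric_def by (simp add: sets_measure_of[OF openin_mtopology_of_Pow])
qed

lemma C_space_continuous:
  assumes "f \<in> mspace (C_space m)"
  shows "continuous_map (top_of_set {0..1}) (mtopology_of m) f" "f \<in> {0..1} \<rightarrow> mspace m"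
  using assms by (simp_all add: C_space_def)

lemma continuous_on_mdist_curve:
  assumes "continuous_map (top_of_set {0..1}) (mtopology_of m) f" "x \<in> mspace m"
  shows "continuous_on {0..1} (\<lambda>s. mdist m x (f s))"
proof -
  have "continuous_map (top_of_set {0..1}) euclidean (\<lambda>s. mdist m x (f s))"
    using assms by (intro continuous_map_mdist) auto
  then show ?thesis by simp
qed

lemma continuous_map_eval_C_space:
  assumes u: "u \<in> {0..1}"
  shows "continuous_map (mtopology_of (C_space m)) (mtopology_of m) (\<lambda>f. f u)"
proof (rule Lipschitz_continuous_imp_continuous_map)
  have "mdist m (f u) (g u) \<le> mdist (C_space m) f g"
    if "f \<in> mspace (C_space m)" "g \<in> mspace (C_space m)" for f g
    unfolding C_space_def
    by (rule mdist_cfunspace_imp_mdist_le[OF that[unfolded C_space_def] order_refl]) (use u in simp)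
  moreover have "(\<lambda>f. f u) \<in> mspace (C_space m) \<rightarrow> mspace m"
    using funcset_mem[OF C_space_continuous(2) u] by (rule funcsetI)
  ultimately show "Lipschitz_continuous_map (C_space m) m (\<lambda>f. f u)"
    unfolding Lipschitz_continuous_map_def by (intro conjI exI[of _ 1]) simp_all
qed

lemma borel_measurable_mdist_eval:
  assumes "u \<in> {0..1}" "v \<in> {0..1}"
  shows "(\<lambda>f. mdist m (f u) (f v)) \<in> borel_measurable (borel_of_metric (C_space m))"
  by (rule borel_measurable_borel_of_metric, rule continuous_map_mdist)
     (rule continuous_map_eval_C_space, fact)+

text \<open>For every \<open>n\<close> the approximation takes countably many values as \<open>x\<close> varies. A function
that is continuous in time is thus a limit of functions that are jointly measurable as soon as it is measurable at
each fixed time.\<close>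

lemma tendsto_floor_fraction:
  fixes x :: real
  shows "(\<lambda>n. real_of_int \<lfloor>real (Suc n) * x\<rfloor> / real (Suc n)) \<longlonglongrightarrow> x"
proof (rule real_tendsto_sandwich)
  show "(\<lambda>n. x - inverse (real (Suc n))) \<longlonglongrightarrow> x"
    using LIMSEQ_inverse_real_of_nat_add_minus[of x] by simp
  show "\<forall>\<^sub>F n in sequentially. x - inverse (real (Suc n)) \<le> real_of_int \<lfloor>real (Suc n) * x\<rfloor> / real (Suc n)"
  proof (rule always_eventually, rule allI)
    fix n
    have "(x - inverse (real (Suc n))) * real (Suc n) = real (Suc n) * x - 1"
      by (simp add: left_diff_distrib del: of_nat_Suc)
    also have "\<dots> \<le> real_of_int \<lfloor>real (Suc n) * x\<rfloor>" by linarith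
    finally show "x - inverse (real (Suc n)) \<le> real_of_int \<lfloor>real (Suc n) * x\<rfloor> / real (Suc n)"
      by (subst pos_le_divide_eq) auto
  qed
  show "\<forall>\<^sub>F n in sequentially. real_of_int \<lfloor>real (Suc n) * x\<rfloor> / real (Suc n) \<le> x"
  proof (rule always_eventually, rule allI)
    fix n show "real_of_int \<lfloor>real (Suc n) * x\<rfloor> / real (Suc n) \<le> x"
      by (subst pos_divide_le_eq) (auto simp: mult.commute simp del: of_nat_Suc)
  qed
qed simp

lemma borel_measurable_mdist_eval_joint:
  assumes q: "q \<in> {0..1}"
  shows "(\<lambda>(f, s). mdist m (f q) (f (max 0 (min 1 s)))) \<in>
    borel_measurable (borel_of_metric (C_space m) \<Otimes>\<^sub>M borel)"
proof -
  define c :: "real \<Rightarrow> real" where "c s = max 0 (min 1 s)" for s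
  have c: "c s \<in> {0..1}" for s by (simp add: c_def)
  have [measurable]: "c \<in> borel_measurable borel" unfolding c_def by measurable
  let ?M = "borel_of_metric (C_space m) \<Otimes>\<^sub>M (borel :: real measure)"
  let ?k = "\<lambda>n x. \<lfloor>real (Suc n) * c (snd x)\<rfloor>"
  have "(\<lambda>x. mdist m (fst x q) (fst x (c (snd x)))) \<in> borel_measurable ?M"
  proof (rule borel_measurable_LIMSEQ_real)
    show "(\<lambda>x. mdist m (fst x q) (fst x (c (real_of_int (?k n x) / real (Suc n))))) \<in> borel_measurable ?M" for n
    proof (rule measurable_compose_countable[where g = "?k n"])
      show "(\<lambda>x. mdist m (fst x q) (fst x (c (real_of_int i / real (Suc n))))) \<in> borel_measurable ?M" for i
        using measurable_compose[OF measurable_fst borel_measurable_mdist_eval[OF q c]] .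
      show "?k n \<in> measurable ?M (count_space UNIV)" by measurable
    qed
  next
    fix x assume "x \<in> space ?M"
    then have f: "fst x \<in> mspace (C_space m)" by (auto simp: space_pair_measure)
    have "(\<lambda>n. real_of_int (?k n x) / real (Suc n)) \<longlonglongrightarrow> c (snd x)"
      by (rule tendsto_floor_fraction)
    then have "(\<lambda>n. c (real_of_int (?k n x) / real (Suc n))) \<longlonglongrightarrow> c (c (snd x))"
      unfolding c_def by (intro tendsto_intros)
    then have lim: "(\<lambda>n. c (real_of_int (?k n x) / real (Suc n))) \<longlonglongrightarrow> c (snd x)"
      by (simp add: c_def)
    have "fst x q \<in> mspace m" using C_space_continuous(2)[OF f] q by auto
    then have "continuous_on {0..1} (\<lambda>s. mdist m (fst x q) (fst x s))"
      by (rule continuous_on_mdist_curve[OF C_space_continuous(1)[OF f]])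
    then show "(\<lambda>n. mdist m (fst x q) (fst x (c (real_of_int (?k n x) / real (Suc n)))))
        \<longlonglongrightarrow> mdist m (fst x q) (fst x (c (snd x)))"
      by (rule continuous_on_tendsto_compose[OF _ lim c]) (simp add: c del: atLeastAtMost_iff)
  qed
  then show ?thesis by (simp add: c_def split_def)
qed

lemma rational_sequence_Icc:
  fixes v :: real assumes "v \<in> {0..1}"
  obtains q where "\<And>k::nat. q k \<in> {0..1} \<inter> \<rat>" "q \<longlonglongrightarrow> v"
proof -
  have "closure ({0<..<1::real} \<inter> \<rat>) = closure {0<..<1}"
    by (rule closure_open_Int_superset) (auto simp: Rats_closure_real)
  then have "v \<in> closure ({0<..<1} \<inter> \<rat>)" using assms by simp
  then obtain q where "\<forall>k. q k \<in> {0<..<1} \<inter> \<rat>" "q \<longlonglongrightarrow> v"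
    unfolding closure_sequential by blast
  then show ?thesis by (intro that[of q]) (auto simp: less_imp_le)
qed

text \<open>By continuity of \<open>f\<close> the supremum of the difference quotients over a punctured neighbourhood is the same
over its rational times, which makes the speed a countable combination of measurable functions.\<close>

lemma metric_speed_eq_countable:
  assumes f: "continuous_map (top_of_set {0..1}) (mtopology_of m) f" and s: "s \<in> {0..1}"
  shows "metric_speed (emdist m) f s = (INF n::nat. SUP q\<in>{0..1} \<inter> \<rat>.
    if q \<noteq> s \<and> \<bar>q - s\<bar> < inverse (real (Suc n)) then emdist m (f s) (f q) / ennreal \<bar>s - q\<bar> else 0)"
    (is "_ = (INF n. ?R n)")
proof (rule antisym)
  show "(INF n. ?R n) \<le> metric_speed (emdist m) f s"
    unfolding metric_speed_def Limsup_def
  proof (rule INF_greatest)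
    fix P assume "P \<in> {P. eventually P (at s within {0..1})}"
    then have "eventually P (at s within {0..1})" by simp
    then obtain d where d: "0 < d" "\<And>v. v \<in> {0..1} \<Longrightarrow> v \<noteq> s \<Longrightarrow> dist v s < d \<Longrightarrow> P v"
      unfolding eventually_at by auto
    obtain n where n: "inverse (real (Suc n)) < d" using reals_Archimedean[OF d(1)] by blast
    show "(INF n. ?R n) \<le> (SUP v\<in>Collect P. emdist m (f s) (f v) / ennreal \<bar>s - v\<bar>)"
    proof (rule INF_lower2[OF UNIV_I, of _ n], rule SUP_least)
      fix q assume q: "q \<in> {0..1} \<inter> (\<rat> :: real set)"
      have "P q" if "q \<noteq> s" "\<bar>q - s\<bar> < inverse (real (Suc n))"
        using q that n by (intro d(2)) (auto simp: dist_real_def)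
      then show "(if q \<noteq> s \<and> \<bar>q - s\<bar> < inverse (real (Suc n)) then emdist m (f s) (f q) / ennreal \<bar>s - q\<bar> else 0)
          \<le> (SUP v\<in>Collect P. emdist m (f s) (f v) / ennreal \<bar>s - v\<bar>)"
        by (auto intro: SUP_upper)
    qed
  qed
next
  have sp: "f s \<in> mspace m" using f s by (auto simp: continuous_map_def)
  note cont = continuous_on_mdist_curve[OF f sp]
  show "metric_speed (emdist m) f s \<le> (INF n. ?R n)"
  proof (rule INF_greatest)
    fix n
    have "emdist m (f s) (f v) / ennreal \<bar>s - v\<bar> \<le> ?R n"
      if v: "v \<in> {0..1}" "v \<noteq> s" "dist v s < inverse (real (Suc n))" for v
    proof -
      obtain q where q: "\<And>k::nat. q k \<in> {0..1} \<inter> \<rat>" "q \<longlonglongrightarrow> v"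
        using rational_sequence_Icc[OF v(1)] by blast
      have "(\<lambda>k. mdist m (f s) (f (q k))) \<longlonglongrightarrow> mdist m (f s) (f v)"
        by (rule continuous_on_tendsto_compose[OF cont q(2) v(1)]) (use q(1) in auto)
      then have "(\<lambda>k. ennreal (mdist m (f s) (f (q k)) / \<bar>s - q k\<bar>)) \<longlonglongrightarrow> ennreal (mdist m (f s) (f v) / \<bar>s - v\<bar>)"
        using v(2) q(2) by (intro tendsto_ennrealI tendsto_intros) auto
      moreover have "eventually (\<lambda>k. ennreal (mdist m (f s) (f (q k)) / \<bar>s - q k\<bar>) \<le> ?R n) sequentially"
      proof -
        have lim: "(\<lambda>k. \<bar>q k - s\<bar>) \<longlonglongrightarrow> \<bar>v - s\<bar>" using q(2) by (intro tendsto_intros)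
        have "eventually (\<lambda>k. \<bar>q k - s\<bar> < inverse (real (Suc n))) sequentially"
            "eventually (\<lambda>k. 0 < \<bar>q k - s\<bar>) sequentially"
          using order_tendstoD(2)[OF lim, of "inverse (real (Suc n))"] order_tendstoD(1)[OF lim, of 0] v
          by (auto simp: dist_real_def)
        then show ?thesis
        proof eventually_elim
          case (elim k)
          then have "ennreal (mdist m (f s) (f (q k)) / \<bar>s - q k\<bar>) = (if q k \<noteq> s \<and> \<bar>q k - s\<bar> < inverse (real (Suc n))
              then emdist m (f s) (f (q k)) / ennreal \<bar>s - q k\<bar> else 0)"
            by (auto simp: divide_ennreal)
          also have "\<dots> \<le> ?R n" by (rule SUP_upper[OF q(1)])
          finally show ?case .
        qed
      qed
      ultimately have "ennreal (mdist m (f s) (f v) / \<bar>s - v\<bar>) \<le> ?R n"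
        by (intro tendsto_upperbound) auto
      then show ?thesis using v(2) by (simp add: divide_ennreal)
    qed
    then show "metric_speed (emdist m) f s \<le> ?R n"
      unfolding metric_speed_def
      by (intro Limsup_bounded) (auto simp: eventually_at intro!: exI[of _ "inverse (real (Suc n))"])
  qed
qed

lemma borel_measurable_metric_speed_joint:
  "(\<lambda>(f, s). metric_speed (emdist m) f s * indicator {0..1} s) \<in>
    borel_measurable (borel_of_metric (C_space m) \<Otimes>\<^sub>M borel)"
proof -
  let ?M = "borel_of_metric (C_space m) \<Otimes>\<^sub>M (borel :: real measure)"
  define D where "D q x = mdist m (fst x q) (fst x (max 0 (min 1 (snd x))))" for q :: real and x :: "(real \<Rightarrow> 'a) \<times> real"
  have D: "D q \<in> borel_measurable ?M" if "q \<in> {0..1} \<inter> \<rat>" for q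
    using borel_measurable_mdist_eval_joint[of q m] that by (simp add: D_def[abs_def] split_def)
  have "(\<lambda>x. (INF n::nat. SUP q\<in>{0..1} \<inter> \<rat>.
      if q \<noteq> snd x \<and> \<bar>q - snd x\<bar> < inverse (real (Suc n)) then ennreal (D q x) / ennreal \<bar>snd x - q\<bar> else 0)
      * indicator {0..1} (snd x)) \<in> borel_measurable ?M"
  proof (intro borel_measurable_times_ennreal borel_measurable_INF borel_measurable_SUP)
    fix n :: nat and q :: real assume q: "q \<in> {0..1} \<inter> \<rat>"
    note [measurable] = D[OF q]
    show "(\<lambda>x. if q \<noteq> snd x \<and> \<bar>q - snd x\<bar> < inverse (real (Suc n))
        then ennreal (D q x) / ennreal \<bar>snd x - q\<bar> else 0) \<in> borel_measurable ?M"
      by measurable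
  qed (auto intro: countable_Int2 countable_rat)
  also have "?this \<longleftrightarrow> ?thesis"
  proof (intro measurable_cong)
    fix x assume "x \<in> space ?M"
    then have f: "fst x \<in> mspace (C_space m)" by (auto simp: space_pair_measure)
    show "(INF n::nat. SUP q\<in>{0..1} \<inter> \<rat>.
      if q \<noteq> snd x \<and> \<bar>q - snd x\<bar> < inverse (real (Suc n)) then ennreal (D q x) / ennreal \<bar>snd x - q\<bar> else 0)
      * indicator {0..1} (snd x) = (case x of (f, s) \<Rightarrow> metric_speed (emdist m) f s * indicator {0..1} s)"
    proof (cases "snd x \<in> {0..1}")
      case True
      then have "max 0 (min 1 (snd x)) = snd x" by auto
      then show ?thesis
        using metric_speed_eq_countable[OF C_space_continuous(1)[OF f] True]
        by (simp add: D_def split_def mdist_commute)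
    qed (simp add: split_def)
  qed
  finally show ?thesis .
qed

section \<open>Absolutely continuous curves and their speed\<close>

lemma mdist_reverse_triangle:
  assumes "x \<in> mspace m" "y \<in> mspace m" "z \<in> mspace m"
  shows "\<bar>mdist m x y - mdist m x z\<bar> \<le> mdist m y z"
  using mdist_triangle[of x m y z] mdist_triangle[of x m z y] assms
  by (auto simp: mdist_commute)

text \<open>The metric speed of an absolutely continuous curve is itself an upper density for its increments. The real function
\<open>d(f u, f \<cdot>)\<close> has difference quotients dominated by those of \<open>f\<close>; its slopes are bounded by the
speed wherever that is finite, and the density from absolute continuity takes care of the remaining null set.\<close>

lemma mdist_le_integral_metric_speed:
  assumes p: "1 \<le> p" and f: "f \<in> AC p (mspace m) (emdist m)"
    and meas: "(\<lambda>s. metric_speed (emdist m) f s * indicator {0..1} s) \<in> borel_measurable borel"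
    and uv: "0 \<le> u" "u \<le> v" "v \<le> 1"
  shows "emdist m (f u) (f v) \<le> (\<integral>\<^sup>+s\<in>{u..v}. metric_speed (emdist m) f s \<partial>lborel)"
proof (cases "(\<integral>\<^sup>+s\<in>{u..v}. metric_speed (emdist m) f s \<partial>lborel) = \<infinity>")
  case False
  let ?S = "metric_speed (emdist m) f"
  define \<phi> where "\<phi> s = enn2real (?S s * indicator {u..v} s)" for s
  define N where "N = {s. ?S s * indicator {u..v} s = \<infinity>}"
  have "(\<lambda>s. ?S s * indicator {0..1} s * indicator {u..v} s) \<in> borel_measurable borel"
    using meas by measurable
  also have "(\<lambda>s. ?S s * indicator {0..1} s * indicator {u..v} s) = (\<lambda>s. ?S s * indicator {u..v} s)"
    using uv by (auto simp: indicator_def)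
  finally have [measurable]: "(\<lambda>s. ?S s * indicator {u..v} s) \<in> borel_measurable borel" .
  have fin: "AE s in lborel. ?S s * indicator {u..v} s \<noteq> \<infinity>"
    using False by (intro nn_integral_PInf_AE) auto
  have "N \<in> null_sets lborel"
    using fin by (subst (asm) AE_iff_null) (auto simp: N_def)
  then have N: "negligible N" by (simp add: negligible_iff_null_sets null_sets_completionI)
  have [measurable]: "\<phi> \<in> borel_measurable borel" unfolding \<phi>_def by measurable
  have nn\<phi>: "(\<integral>\<^sup>+s. ennreal (\<phi> s) \<partial>lborel) = (\<integral>\<^sup>+s\<in>{u..v}. ?S s \<partial>lborel)"
    using fin by (intro nn_integral_cong_AE) (auto elim!: eventually_mono simp: \<phi>_def less_top)
  have \<phi>0: "0 \<le> \<phi> s" for s by (simp add: \<phi>_def)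
  have \<phi>int: "\<phi> integrable_on UNIV" "(\<integral>\<^sup>+s. ennreal (\<phi> s) \<partial>lborel) = ennreal (integral UNIV \<phi>)"
    using nn_integral_integrable_on[of \<phi>] nn_integral_lborel_eq_integral[of \<phi>] False nn\<phi> \<phi>0
    by (auto simp: less_top)
  have \<phi>uv: "\<phi> integrable_on {u..v}" using integrable_on_subcbox[OF \<phi>int(1), of u v] by simp
  have \<phi>le: "integral {u..v} \<phi> \<le> integral UNIV \<phi>"
    using \<phi>uv \<phi>int(1) \<phi>0 by (intro integral_subset_le) auto
  obtain M where fS: "f \<in> {0..1} \<rightarrow> mspace m" and M: "set_borel_measurable lborel {0..1} M"
    "set_integrable lborel {0..1} (\<lambda>r. \<bar>M r\<bar> powr p)"
    "\<And>u v. 0 \<le> u \<Longrightarrow> u \<le> v \<Longrightarrow> v \<le> 1 \<Longrightarrow> emdist m (f u) (f v) \<le> ennreal (LINT r:{u..v}|lborel. M r)"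
    using f unfolding AC_def by blast
  have Mint: "set_integrable lborel {0..1} M"
  proof -
    have "set_integrable lborel {0..1} (\<lambda>r. 1 + \<bar>M r\<bar> powr p)"
      using M(2) by (intro set_integral_add) (auto simp: set_integrable_def)
    moreover have "\<bar>M r\<bar> \<le> 1 + \<bar>M r\<bar> powr p" for r
    proof (cases "\<bar>M r\<bar> \<le> 1")
      case False
      then have "\<bar>M r\<bar> powr 1 \<le> \<bar>M r\<bar> powr p" using p by (intro powr_mono) auto
      then show ?thesis by simp
    qed (simp add: add_increasing2)
    ultimately show ?thesis using M(1)
      unfolding set_integrable_def set_borel_measurable_def
      by (elim Bochner_Integration.integrable_bound) (auto simp: indicator_def)
  qed
  have sub: "set_integrable lborel {x..y} M" "set_integrable lborel {x..y} (\<lambda>r. \<bar>M r\<bar>)"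
    if "0 \<le> x" "y \<le> 1" for x y
    using set_integrable_subset[OF Mint, of "{x..y}"] set_integrable_abs[of lborel "{x..y}" M] that by auto
  \<comment> \<open>The absolute value is needed because a negative integral of \<open>M\<close> is truncated to \<open>0\<close> in \<^typ>\<open>ennreal\<close>.\<close>
  have incr: "mdist m (f x) (f y) \<le> integral {x..y} (\<lambda>r. \<bar>M r\<bar>)" if "0 \<le> x" "x \<le> y" "y \<le> 1" for x y
  proof -
    have "(LINT r:{x..y}|lborel. M r) \<le> (LINT r:{x..y}|lborel. \<bar>M r\<bar>)"
      using that by (intro set_integral_mono sub) auto
    also have "\<dots> = integral {x..y} (\<lambda>r. \<bar>M r\<bar>)"
      using that by (intro set_borel_integral_eq_integral sub)
    finally have le: "(LINT r:{x..y}|lborel. M r) \<le> integral {x..y} (\<lambda>r. \<bar>M r\<bar>)" .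
    have "0 \<le> integral {x..y} (\<lambda>r. \<bar>M r\<bar>)"
      using that set_borel_integral_eq_integral(1)[OF sub(2), of x y] by (intro Henstock_Kurzweil_Integration.integral_nonneg) auto
    moreover have "emdist m (f x) (f y) \<le> ennreal (integral {x..y} (\<lambda>r. \<bar>M r\<bar>))"
      using M(3)[OF that] ennreal_leI[OF le] by (rule order_trans)
    ultimately show ?thesis by simp
  qed
  have mem: "f x \<in> mspace m" if "x \<in> {u..v}" for x using fS that uv by auto
  have "mdist m (f u) (f v) - mdist m (f u) (f u) \<le> integral {u..v} \<phi>"
  proof (rule increment_le_integral_of_slope_bound[where m = "\<lambda>r. \<bar>M r\<bar>" and N = N])
    show "(\<lambda>r. \<bar>M r\<bar>) integrable_on {u..v}"
      using uv by (intro set_borel_integral_eq_integral sub)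
    fix x y assume xy: "u \<le> x" "x \<le> y" "y \<le> v"
    have "\<bar>mdist m (f u) (f y) - mdist m (f u) (f x)\<bar> \<le> mdist m (f x) (f y)"
      using mdist_reverse_triangle[of "f u" m "f y" "f x"] mem[of u] mem[of x] mem[of y] xy
      by (simp add: mdist_commute)
    also have "\<dots> \<le> integral {x..y} (\<lambda>r. \<bar>M r\<bar>)" using xy uv by (intro incr) auto
    finally show "\<bar>mdist m (f u) (f y) - mdist m (f u) (f x)\<bar> \<le> integral {x..y} (\<lambda>r. \<bar>M r\<bar>)" .
  next
    fix x e :: real assume x: "x \<in> {u..v} - N" and e: "0 < e"
    have "?S x \<noteq> \<infinity>" using x by (auto simp: N_def)
    then have "?S x = ennreal (\<phi> x)" using x by (simp add: \<phi>_def less_top)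
    then have "?S x < ennreal (\<phi> x + e)" using e \<phi>0[of x] by (simp add: ennreal_less_iff)
    then have "\<forall>\<^sub>F y in at x within {0..1}. emdist m (f x) (f y) / ennreal \<bar>x - y\<bar> < ennreal (\<phi> x + e)"
      unfolding metric_speed_def by (rule Limsup_lessD)
    then obtain d where d: "0 < d" "\<And>y. y \<in> {0..1} \<Longrightarrow> y \<noteq> x \<Longrightarrow> dist y x < d \<Longrightarrow>
        emdist m (f x) (f y) / ennreal \<bar>x - y\<bar> < ennreal (\<phi> x + e)"
      unfolding eventually_at by auto
    have "\<bar>mdist m (f u) (f y) - mdist m (f u) (f x)\<bar> \<le> (\<phi> x + e) * \<bar>y - x\<bar>"
      if y: "y \<in> {u..v}" "\<bar>y - x\<bar> < d" for y
    proof (cases "y = x")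
      case False
      have "ennreal (mdist m (f x) (f y) / \<bar>x - y\<bar>) < ennreal (\<phi> x + e)"
        using d(2)[of y] y uv False by (auto simp: dist_real_def divide_ennreal)
      then have "mdist m (f x) (f y) / \<bar>x - y\<bar> < \<phi> x + e" by (simp add: ennreal_less_iff)
      then have "mdist m (f x) (f y) \<le> (\<phi> x + e) * \<bar>y - x\<bar>"
        using False by (simp add: divide_less_eq abs_minus_commute)
      moreover have "\<bar>mdist m (f u) (f y) - mdist m (f u) (f x)\<bar> \<le> mdist m (f x) (f y)"
        using mdist_reverse_triangle[of "f u" m "f y" "f x"] mem[of u] mem[of x] mem[of y] x y uv
        by (simp add: mdist_commute)
      ultimately show ?thesis by linarith
    qed simp
    then show "\<exists>d>0. \<forall>y\<in>{u..v}. \<bar>y - x\<bar> < d \<longrightarrow>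
        \<bar>mdist m (f u) (f y) - mdist m (f u) (f x)\<bar> \<le> (\<phi> x + e) * \<bar>y - x\<bar>"
      using d(1) by blast
  qed (use uv \<phi>uv N in auto)
  moreover have "mdist m (f u) (f u) = 0" using mem[of u] uv by simp
  ultimately have "mdist m (f u) (f v) \<le> integral UNIV \<phi>" using \<phi>le by linarith
  then have "emdist m (f u) (f v) \<le> ennreal (integral UNIV \<phi>)" by (rule ennreal_leI)
  then show ?thesis using \<phi>int(2) nn\<phi> by simp
qed simp

section \<open>The mean speed of a random curve\<close>

text \<open>The factor \<open>indicator {0..1} s\<close> lets integrals of this moment over the whole line be integrals over
\<open>[0,1]\<close>, the domain of the curves.\<close>

definition speed_moment :: "real \<Rightarrow> 'a metric \<Rightarrow> (real \<Rightarrow> 'a) measure \<Rightarrow> real \<Rightarrow> ennreal" where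
  "speed_moment p m \<eta> s =
    (\<integral>\<^sup>+f. ennreal_powr (metric_speed (emdist m) f s * indicator {0..1} s) p \<partial>\<eta>)"

definition distance_moment :: "real \<Rightarrow> 'a metric \<Rightarrow> (real \<Rightarrow> 'a) measure \<Rightarrow> real \<Rightarrow> real \<Rightarrow> ennreal" where
  "distance_moment p m \<eta> u v = (\<integral>\<^sup>+f. ennreal (mdist m (f u) (f v) powr p) \<partial>\<eta>)"

lemma distance_moment_commute: "distance_moment p m \<eta> u v = distance_moment p m \<eta> v u"
  by (simp add: distance_moment_def mdist_commute)

locale random_curve = prob_space \<eta> for \<eta> :: "(real \<Rightarrow> 'a) measure" +
  fixes p :: real and m :: "'a metric"
  assumes p: "1 \<le> p"
    and sets_\<eta>: "sets \<eta> = sets (borel_of_metric (C_space m))"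
    and AC_\<eta>: "AE f in \<eta>. f \<in> AC p (mspace m) (emdist m)"
begin

abbreviation S :: "(real \<Rightarrow> 'a) \<Rightarrow> real \<Rightarrow> ennreal" where
  "S f s \<equiv> metric_speed (emdist m) f s * indicator {0..1} s"

abbreviation K :: "real \<Rightarrow> ennreal" where
  "K \<equiv> speed_moment p m \<eta>"

lemma space_\<eta>: "space \<eta> = mspace (C_space m)"
  using sets_eq_imp_space_eq[OF sets_\<eta>] by simp

lemma measurable_S_joint: "(\<lambda>(f, s). S f s) \<in> borel_measurable (\<eta> \<Otimes>\<^sub>M lborel)"
proof -
  have "sets (\<eta> \<Otimes>\<^sub>M lborel) = sets (borel_of_metric (C_space m) \<Otimes>\<^sub>M (borel :: real measure))"
    by (intro sets_pair_measure_cong sets_\<eta>) simp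
  then show ?thesis
    using borel_measurable_metric_speed_joint[of m] measurable_cong_sets by blast
qed

lemma measurable_S_curve: "f \<in> space \<eta> \<Longrightarrow> S f \<in> borel_measurable borel"
  using measurable_compose[OF measurable_Pair1' measurable_S_joint, of f] by simp

lemma measurable_S_time: "(\<lambda>f. S f s) \<in> borel_measurable \<eta>"
  using measurable_compose[OF measurable_Pair2' measurable_S_joint, of s] by simp

lemma measurable_K [measurable]: "K \<in> borel_measurable borel"
proof -
  have [measurable]: "(\<lambda>(s, f). S f s) \<in> borel_measurable (lborel \<Otimes>\<^sub>M \<eta>)"
    using measurable_compose[OF measurable_pair_swap' measurable_S_joint] by (simp add: split_def)
  have "(\<lambda>s. \<integral>\<^sup>+f. ennreal_powr (S f s) p \<partial>\<eta>) \<in> borel_measurable lborel"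
    by measurable
  then show ?thesis by (simp add: speed_moment_def[abs_def])
qed

lemma speed_moment_eq:
  "s \<in> {0..1} \<Longrightarrow> K s = (\<integral>\<^sup>+f. ennreal_powr (metric_speed (emdist m) f s) p \<partial>\<eta>)"
  by (simp add: speed_moment_def)

lemma tonelli:
  assumes [measurable]: "g \<in> borel_measurable borel"
  shows "(\<integral>\<^sup>+f. (\<integral>\<^sup>+s. ennreal_powr (S f s) p * g s \<partial>lborel) \<partial>\<eta>) = (\<integral>\<^sup>+s. K s * g s \<partial>lborel)"
proof -
  interpret pair_sigma_finite \<eta> lborel ..
  note [measurable] = measurable_S_joint measurable_S_time
  have "(\<integral>\<^sup>+f. (\<integral>\<^sup>+s. ennreal_powr (S f s) p * g s \<partial>lborel) \<partial>\<eta>)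
      = (\<integral>\<^sup>+s. (\<integral>\<^sup>+f. ennreal_powr (S f s) p * g s \<partial>\<eta>) \<partial>lborel)"
    by (rule Fubini'[symmetric]) measurable
  also have "\<dots> = (\<integral>\<^sup>+s. K s * g s \<partial>lborel)"
    unfolding speed_moment_def by (intro nn_integral_cong nn_integral_multc) measurable
  finally show ?thesis .
qed

lemma nn_integral_speed_moment:
  "(\<integral>\<^sup>+s. K s \<partial>lborel) = (\<integral>\<^sup>+ f. (\<integral>\<^sup>+ s\<in>{0..1}. ennreal_powr (metric_speed (emdist m) f s) p \<partial>lborel) \<partial>\<eta>)"
proof -
  have "(\<integral>\<^sup>+s. K s \<partial>lborel) = (\<integral>\<^sup>+f. (\<integral>\<^sup>+s. ennreal_powr (S f s) p \<partial>lborel) \<partial>\<eta>)"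
    using tonelli[of "\<lambda>_. 1"] by simp
  also have "\<dots> = (\<integral>\<^sup>+ f. (\<integral>\<^sup>+ s\<in>{0..1}. ennreal_powr (metric_speed (emdist m) f s) p \<partial>lborel) \<partial>\<eta>)"
    using p by (intro nn_integral_cong) (auto simp: indicator_def ennreal_powr_def)
  finally show ?thesis .
qed

text \<open>The basic estimate: the pointwise bound along each curve, from Jensen's inequality with weight \<open>w\<close>, is
integrated over the curves, and Tonelli's theorem moves that integral onto the speed.\<close>

lemma distance_moment_le:
  assumes uv: "0 \<le> u" "v \<le> 1" "u \<le> v"
    and [measurable]: "w \<in> borel_measurable borel" and w: "\<And>s. 0 < w s"
    and A: "(\<integral>\<^sup>+s\<in>{u..v}. ennreal (w s) \<partial>lborel) = ennreal A" "0 < A"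
  shows "distance_moment p m \<eta> u v \<le>
    ennreal (A powr (p - 1)) * (\<integral>\<^sup>+s\<in>{u..v}. K s * ennreal (w s powr (1 - p)) \<partial>lborel)"
proof -
  let ?L = "restrict_space lborel {u..v}"
  let ?g = "\<lambda>s. ennreal (w s powr (1 - p)) * indicator {u..v} s"
  have L: "(\<integral>\<^sup>+s. h s \<partial>?L) = (\<integral>\<^sup>+s\<in>{u..v}. h s \<partial>lborel)" for h
    by (simp add: nn_integral_restrict_space)
  have "AE f in \<eta>. ennreal (mdist m (f u) (f v) powr p) \<le>
      ennreal (A powr (p - 1)) * (\<integral>\<^sup>+s. ennreal_powr (S f s) p * ?g s \<partial>lborel)"
    using AC_\<eta> AE_space
  proof eventually_elim
    case (elim f)
    note [measurable] = measurable_S_curve[OF elim(2)]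
    have "emdist m (f u) (f v) \<le> (\<integral>\<^sup>+s\<in>{u..v}. metric_speed (emdist m) f s \<partial>lborel)"
      using mdist_le_integral_metric_speed[OF p elim(1)] measurable_S_curve[OF elim(2)] uv by simp
    also have "\<dots> = (\<integral>\<^sup>+s. S f s \<partial>?L)"
      unfolding L using uv by (intro nn_integral_cong) (auto simp: indicator_def)
    finally have "ennreal (mdist m (f u) (f v) powr p) \<le> ennreal (A powr (p - 1)) *
        (\<integral>\<^sup>+s. ennreal_powr (S f s) p * ennreal (w s powr (1 - p)) \<partial>?L)"
      by (intro powr_le_weighted_integral p w A(2) mdist_nonneg measurable_restrict_space1)
         (auto simp: L A(1))
    then show ?case by (simp add: L mult.assoc)
  qed
  then have "distance_moment p m \<eta> u v \<le>
      (\<integral>\<^sup>+f. ennreal (A powr (p - 1)) * (\<integral>\<^sup>+s. ennreal_powr (S f s) p * ?g s \<partial>lborel) \<partial>\<eta>)"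
    unfolding distance_moment_def by (rule nn_integral_mono_AE)
  also have "\<dots> = ennreal (A powr (p - 1)) * (\<integral>\<^sup>+f. (\<integral>\<^sup>+s. ennreal_powr (S f s) p * ?g s \<partial>lborel) \<partial>\<eta>)"
  proof (rule nn_integral_cmult)
    note [measurable] = measurable_S_joint
    show "(\<lambda>f. \<integral>\<^sup>+s. ennreal_powr (S f s) p * ?g s \<partial>lborel) \<in> borel_measurable \<eta>" by measurable
  qed
  also have "\<dots> = ennreal (A powr (p - 1)) * (\<integral>\<^sup>+s. K s * ?g s \<partial>lborel)"
    by (subst tonelli) auto
  finally show ?thesis by (simp add: mult.assoc)
qed

lemma distance_moment_refl:
  assumes "u \<in> {0..1}" shows "distance_moment p m \<eta> u u = 0"
proof -
  have "mdist m (f u) (f u) = 0" if "f \<in> space \<eta>" for f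
    using funcset_mem[OF C_space_continuous(2) assms, of f m] that by (simp add: space_\<eta>)
  then have "distance_moment p m \<eta> u u = (\<integral>\<^sup>+f. 0 \<partial>\<eta>)"
    unfolding distance_moment_def by (intro nn_integral_cong) simp
  then show ?thesis by simp
qed

end

locale finite_energy_random_curve = random_curve +
  assumes finite_energy: "(\<integral>\<^sup>+s. K s \<partial>lborel) < \<infinity>"
begin

definition energy_density :: "real \<Rightarrow> real" where "energy_density s = enn2real (K s)"

text \<open>The weight for which the basic estimate closes up: \<open>energy_density * w powr (1 - p) \<le> w\<close>. The summand \<open>1\<close>
keeps it positive, and its \<open>p\<close>-th power stays integrable on \<open>[0,1]\<close>.\<close>

definition ac_density :: "real \<Rightarrow> real" where "ac_density s = (1 + energy_density s) powr (1 / p)"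

lemma measurable_energy_density [measurable]: "energy_density \<in> borel_measurable borel"
  unfolding energy_density_def by measurable

lemma measurable_ac_density [measurable]: "ac_density \<in> borel_measurable borel"
  unfolding ac_density_def by measurable

lemma energy_density_nonneg: "0 \<le> energy_density s" by (simp add: energy_density_def)

lemma AE_K_eq_energy_density: "AE s in lborel. K s = ennreal (energy_density s)"
  using nn_integral_PInf_AE[of K lborel] finite_energy
  by (auto simp: energy_density_def less_top elim!: eventually_mono)

lemma ac_density_ge_1: "1 \<le> ac_density s"
  using p energy_density_nonneg[of s] by (simp add: ac_density_def ge_one_powr_ge_zero)

lemma ac_density_powr_p: "ac_density s powr p = 1 + energy_density s"
  using p energy_density_nonneg[of s] by (simp add: ac_density_def powr_powr)

lemma integrable_energy_density: "integrable lborel energy_density"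
proof (rule integrableI_nonneg)
  have "(\<integral>\<^sup>+s. ennreal (energy_density s) \<partial>lborel) = (\<integral>\<^sup>+s. K s \<partial>lborel)"
    using AE_K_eq_energy_density by (intro nn_integral_cong_AE) (auto elim!: eventually_mono)
  then show "(\<integral>\<^sup>+s. ennreal (energy_density s) \<partial>lborel) < \<infinity>" using finite_energy by simp
qed (auto simp: energy_density_nonneg)

lemma set_integrable_energy_density: "set_integrable lborel {u..v} energy_density"
  unfolding set_integrable_def using integrable_mult_indicator[OF _ integrable_energy_density, of "{u..v}"] by simp

lemma set_integrable_1_plus_energy: "set_integrable lborel {u..v} (\<lambda>s. 1 + energy_density s)"
proof (intro set_integral_add set_integrable_energy_density)
  show "set_integrable lborel {u..v} (\<lambda>s. 1 :: real)"
    using borel_integrable_compact[OF compact_Icc continuous_on_const, of u v "1 :: real"]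
    by (simp add: set_integrable_def indicator_def if_distrib cong: if_cong)
qed

lemma set_integrable_ac_density: "set_integrable lborel {u..v} ac_density"
proof -
  have "\<bar>ac_density s\<bar> \<le> \<bar>1 + energy_density s\<bar>" for s
    using powr_mono[of 1 p "ac_density s"] ac_density_ge_1[of s] p ac_density_powr_p[of s] by simp
  then show ?thesis
    using set_integrable_1_plus_energy[of u v] unfolding set_integrable_def
    by (elim Bochner_Integration.integrable_bound) (auto simp: indicator_def)
qed

lemma nn_integral_ac_density: "(\<integral>\<^sup>+s\<in>{u..v}. ennreal (ac_density s) \<partial>lborel) = ennreal (LINT s:{u..v}|lborel. ac_density s)"
proof -
  have "(\<integral>\<^sup>+s\<in>{u..v}. ennreal (ac_density s) \<partial>lborel) = (\<integral>\<^sup>+s. ennreal (indicator {u..v} s *\<^sub>R ac_density s) \<partial>lborel)"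
    by (intro nn_integral_cong) (simp add: indicator_def)
  also have "\<dots> = ennreal (LINT s:{u..v}|lborel. ac_density s)"
    using set_integrable_ac_density[of u v] order_trans[OF zero_le_one ac_density_ge_1]
    unfolding set_integrable_def set_lebesgue_integral_def
    by (intro nn_integral_eq_integral) (auto intro!: AE_I2)
  finally show ?thesis .
qed

lemma distance_moment_le_ac_density:
  assumes uv: "0 \<le> u" "u \<le> v" "v \<le> 1"
  shows "distance_moment p m \<eta> u v \<le> ennreal ((LINT s:{u..v}|lborel. ac_density s) powr p)"
proof (cases "u = v")
  case True then show ?thesis using distance_moment_refl[of u] uv by simp
next
  case False
  define A where "A = (LINT s:{u..v}|lborel. ac_density s)"
  have "ennreal (v - u) = (\<integral>\<^sup>+s\<in>{u..v}. ennreal 1 \<partial>lborel)" using uv by simp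
  also have "\<dots> \<le> (\<integral>\<^sup>+s\<in>{u..v}. ennreal (ac_density s) \<partial>lborel)"
    using ac_density_ge_1 by (intro nn_integral_mono mult_right_mono ennreal_leI) auto
  finally have "ennreal (v - u) \<le> ennreal A" by (simp add: nn_integral_ac_density A_def)
  then have A: "0 < A" using uv False by (simp add: ennreal_le_iff2)
  have "distance_moment p m \<eta> u v \<le>
      ennreal (A powr (p - 1)) * (\<integral>\<^sup>+s\<in>{u..v}. K s * ennreal (ac_density s powr (1 - p)) \<partial>lborel)"
    by (rule distance_moment_le) (use uv ac_density_ge_1 A in \<open>auto simp: nn_integral_ac_density A_def less_le_trans[OF zero_less_one]\<close>)
  also have "(\<integral>\<^sup>+s\<in>{u..v}. K s * ennreal (ac_density s powr (1 - p)) \<partial>lborel) \<le> (\<integral>\<^sup>+s\<in>{u..v}. ennreal (ac_density s) \<partial>lborel)"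
  proof (rule nn_integral_mono_AE, use AE_K_eq_energy_density in eventually_elim)
    case (elim s)
    have "energy_density s * ac_density s powr (1 - p) \<le> ac_density s powr p * ac_density s powr (1 - p)"
      by (intro mult_right_mono) (auto simp: ac_density_powr_p)
    also have "\<dots> = ac_density s" using ac_density_ge_1[of s] by (simp flip: powr_add)
    finally have "K s * ennreal (ac_density s powr (1 - p)) \<le> ennreal (ac_density s)"
      using energy_density_nonneg[of s] by (simp add: elim ennreal_leI flip: ennreal_mult)
    then show ?case by (rule mult_right_mono) simp
  qed
  also have "ennreal (A powr (p - 1)) * (\<integral>\<^sup>+s\<in>{u..v}. ennreal (ac_density s) \<partial>lborel) = ennreal (A powr p)"
    using A by (simp add: nn_integral_ac_density powr_diff flip: A_def ennreal_mult)
  finally show ?thesis by (simp add: A_def mult_left_mono)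
qed

lemma distance_moment_le_energy:
  assumes uv: "0 \<le> u" "u < v" "v \<le> 1"
  shows "distance_moment p m \<eta> u v \<le> ennreal ((v - u) powr (p - 1) * integral {u..v} energy_density)"
proof -
  have "distance_moment p m \<eta> u v \<le>
      ennreal ((v - u) powr (p - 1)) * (\<integral>\<^sup>+s\<in>{u..v}. K s * ennreal (1 powr (1 - p)) \<partial>lborel)"
    by (rule distance_moment_le) (use uv in auto)
  also have "(\<integral>\<^sup>+s\<in>{u..v}. K s * ennreal (1 powr (1 - p)) \<partial>lborel) = (\<integral>\<^sup>+s. ennreal (indicator {u..v} s *\<^sub>R energy_density s) \<partial>lborel)"
    using AE_K_eq_energy_density by (intro nn_integral_cong_AE) (auto elim!: eventually_mono simp: indicator_def)
  also have "\<dots> = ennreal (LINT s:{u..v}|lborel. energy_density s)"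
    using set_integrable_energy_density[of u v] energy_density_nonneg unfolding set_integrable_def set_lebesgue_integral_def
    by (intro nn_integral_eq_integral) (auto intro!: AE_I2)
  also have "(LINT s:{u..v}|lborel. energy_density s) = integral {u..v} energy_density"
    by (rule set_borel_integral_eq_integral[OF set_integrable_energy_density])
  finally show ?thesis by (simp add: ennreal_mult')
qed

text \<open>The estimate with weight \<open>1\<close>, localised at almost every time by Lebesgue differentiation.\<close>

lemma distance_moment_local:
  obtains N where "negligible N"
    "\<And>x e. x \<in> {0..1} - N \<Longrightarrow> 0 < e \<Longrightarrow> \<exists>d>0. \<forall>y\<in>{0..1}. y \<noteq> x \<longrightarrow> \<bar>y - x\<bar> < d \<longrightarrow>
      distance_moment p m \<eta> x y \<le> ennreal ((energy_density x + e) * \<bar>y - x\<bar> powr p)"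
proof -
  have energy_density: "energy_density integrable_on {0..1}" by (rule set_borel_integral_eq_integral[OF set_integrable_energy_density])
  obtain N where N: "negligible N"
    "\<And>x c. x \<in> {0..1} - N \<Longrightarrow> 0 < c \<Longrightarrow> \<exists>d>0. \<forall>y\<in>{0..1}. \<bar>y - x\<bar> < d \<longrightarrow>
      integral {min x y..max x y} energy_density \<le> (energy_density x + c) * \<bar>y - x\<bar>"
    using mean_le_value_near[OF energy_density] by blast
  show ?thesis
  proof (rule that[OF N(1)])
    fix x e :: real assume x: "x \<in> {0..1} - N" and e: "0 < e"
    obtain d where d: "0 < d" "\<And>y. y \<in> {0..1} \<Longrightarrow> \<bar>y - x\<bar> < d \<Longrightarrow>
        integral {min x y..max x y} energy_density \<le> (energy_density x + e) * \<bar>y - x\<bar>"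
      using N(2)[OF x e] by blast
    have "distance_moment p m \<eta> x y \<le> ennreal ((energy_density x + e) * \<bar>y - x\<bar> powr p)"
      if y: "y \<in> {0..1}" "y \<noteq> x" "\<bar>y - x\<bar> < d" for y
    proof -
      have eq: "max x y - min x y = \<bar>y - x\<bar>" by (simp add: max_def min_def)
      have "distance_moment p m \<eta> x y = distance_moment p m \<eta> (min x y) (max x y)"
        by (simp add: max_def min_def distance_moment_commute)
      also have "\<dots> \<le> ennreal (\<bar>y - x\<bar> powr (p - 1) * integral {min x y..max x y} energy_density)"
        using distance_moment_le_energy[of "min x y" "max x y"] x y unfolding eq by auto
      also have "\<dots> \<le> ennreal (\<bar>y - x\<bar> powr (p - 1) * ((energy_density x + e) * \<bar>y - x\<bar>))"
        using d(2) y by (intro ennreal_leI mult_left_mono) auto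
      also have "\<bar>y - x\<bar> powr (p - 1) * ((energy_density x + e) * \<bar>y - x\<bar>) = (energy_density x + e) * \<bar>y - x\<bar> powr p"
        using y(2) by (simp add: powr_diff)
      finally show ?thesis .
    qed
    then show "\<exists>d>0. \<forall>y\<in>{0..1}. y \<noteq> x \<longrightarrow> \<bar>y - x\<bar> < d \<longrightarrow>
        distance_moment p m \<eta> x y \<le> ennreal ((energy_density x + e) * \<bar>y - x\<bar> powr p)"
      using d(1) by blast
  qed
qed

end

section \<open>The curve of filtered processes\<close>

lemma path_law_random_curve:
  assumes "1 \<le> p" "prob_space P" "has_path_law P m Y \<eta>"
    "AE f in \<eta>. f \<in> AC p (mspace m) (emdist m)"
  shows "random_curve \<eta> p m"
proof -
  obtain Z where Z: "Z \<in> measurable P (borel_of_metric (C_space m))"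
    "\<eta> = distr P (borel_of_metric (C_space m)) Z"
    using assms(3) unfolding has_path_law_def by blast
  interpret prob_space \<eta>
    unfolding Z(2) by (rule prob_space.prob_space_distr[OF assms(2) Z(1)])
  show ?thesis by unfold_locales (use assms Z(2) in auto)
qed

text \<open>The function \<open>g\<close> is a measurable version of the distance: over an incomplete \<open>P\<close> the distance itself, being
only almost surely a function of the random curve, may fail to be measurable.\<close>

lemma distance_moment_path_law:
  assumes "has_path_law P m Y \<eta>" and uv: "u \<in> {0..1}" "v \<in> {0..1}"
  shows "\<exists>g\<in>borel_measurable P. (AE \<omega> in P. g \<omega> = ennreal (mdist m (Y u \<omega>) (Y v \<omega>) powr p)) \<and>
    (\<integral>\<^sup>+\<omega>. g \<omega> \<partial>P) = distance_moment p m \<eta> u v"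
proof -
  obtain Z where Z: "Z \<in> measurable P (borel_of_metric (C_space m))"
    "AE \<omega> in P. Z \<omega> = (\<lambda>u\<in>{0..1}. Y u \<omega>)" "\<eta> = distr P (borel_of_metric (C_space m)) Z"
    using assms(1) unfolding has_path_law_def by blast
  let ?h = "\<lambda>f. ennreal (mdist m (f u) (f v) powr p)"
  note [measurable] = Z(1) borel_measurable_mdist_eval[OF uv]
  have h: "?h \<in> borel_measurable (borel_of_metric (C_space m))" by measurable
  show ?thesis
  proof (intro bexI conjI)
    show "AE \<omega> in P. ?h (Z \<omega>) = ennreal (mdist m (Y u \<omega>) (Y v \<omega>) powr p)"
      using Z(2) by eventually_elim (use uv in simp)
    show "(\<integral>\<^sup>+\<omega>. ?h (Z \<omega>) \<partial>P) = distance_moment p m \<eta> u v"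
      unfolding distance_moment_def Z(3) using h by (simp add: nn_integral_distr[OF Z(1)])
  qed measurable
qed

lemma AW_le_distance_moment:
  assumes p: "1 \<le> p" and F: "filtered_prob_space T P F"
    and Y: "has_path_law P (path_space p T X) Y \<eta>" and uv: "u \<in> {0..1}" "v \<in> {0..1}"
  shows "AW p T X \<lparr>prob_of = P, filt = F, proc = Y u\<rparr> \<lparr>prob_of = P, filt = F, proc = Y v\<rparr>
    \<le> ennreal_powr (distance_moment p (path_space p T X) \<eta> u v) (1 / p)"
proof -
  obtain g where g: "AE \<omega> in P. g \<omega> = ennreal (mdist (path_space p T X) (Y u \<omega>) (Y v \<omega>) powr p)"
    "(\<integral>\<^sup>+\<omega>. g \<omega> \<partial>P) = distance_moment p (path_space p T X) \<eta> u v"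
    using distance_moment_path_law[OF Y uv, of p] by blast
  have "(\<integral>\<^sup>+\<omega>. ennreal (mdist (path_space p T X) (Y u \<omega>) (Y v \<omega>) powr p) \<partial>P)
      = distance_moment p (path_space p T X) \<eta> u v"
    unfolding g(2)[symmetric] using g(1) by (intro nn_integral_cong_AE) (auto elim!: eventually_mono)
  then show ?thesis using AW_le_diagonal_cost[OF p F, of X "Y u" "Y v"] by simp
qed

lemma borel_measurable_path_dist_adapted:
  assumes F: "filtered_prob_space T P F" and Y: "adapted T X P F Y"
    and x: "x \<in> (\<Pi>\<^sub>E t\<in>{1..T}. mspace (X t))"
  shows "(\<lambda>\<omega>. path_dist p T X (Y \<omega>) x) \<in> borel_measurable P"
proof -
  have "(\<lambda>\<omega>. mdist (X t) (Y \<omega> t) (x t)) \<in> borel_measurable P" if t: "t \<in> {1..T}" for t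
  proof -
    have "(\<lambda>y. mdist (X t) y (x t)) \<in> borel_measurable (borel_of_metric (X t))"
      using x t by (intro borel_measurable_borel_of_metric continuous_map_mdist) (auto simp: PiE_iff)
    moreover have "(\<lambda>\<omega>. Y \<omega> t) \<in> measurable P (borel_of_metric (X t))"
      using Y F t by (intro measurable_from_subalg[of P "F t"]) (auto simp: adapted_def filtered_prob_space_def)
    ultimately show ?thesis by (rule measurable_compose[rotated])
  qed
  then show ?thesis unfolding path_dist_def by measurable
qed

lemma powr_add_le:
  fixes a b p :: real
  assumes "0 \<le> a" "0 \<le> b" "0 \<le> p"
  shows "(a + b) powr p \<le> 2 powr p * (a powr p + b powr p)"
proof -
  have "(a + b) powr p \<le> (2 * max a b) powr p" using assms by (intro powr_mono2) auto
  also have "\<dots> = 2 powr p * max a b powr p" using assms by (simp add: powr_mult)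
  also have "max a b powr p \<le> a powr p + b powr p" by (simp add: max_def)
  finally show ?thesis by simp
qed

lemma FP_of_finite_distance_moment:
  assumes p: "1 \<le> p" and F: "filtered_prob_space T P F"
    and ad: "adapted T X P F (Y u)" "adapted T X P F (Y v)"
    and law: "has_path_law P (path_space p T X) Y \<eta>"
    and Yu: "\<lparr>prob_of = P, filt = F, proc = Y u\<rparr> \<in> FP p T X"
    and uv: "u \<in> {0..1}" "v \<in> {0..1}"
    and fin: "distance_moment p (path_space p T X) \<eta> v u < \<infinity>"
  shows "\<lparr>prob_of = P, filt = F, proc = Y v\<rparr> \<in> FP p T X"
proof -
  let ?d = "mdist (path_space p T X)"
  obtain x where x: "x \<in> mspace (path_space p T X)"
    "(\<integral>\<^sup>+\<omega>. ennreal (?d (Y u \<omega>) x powr p) \<partial>P) < \<infinity>"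
    using Yu unfolding FP_def by auto
  obtain g where g: "g \<in> borel_measurable P" "AE \<omega> in P. g \<omega> = ennreal (?d (Y v \<omega>) (Y u \<omega>) powr p)"
    "(\<integral>\<^sup>+\<omega>. g \<omega> \<partial>P) = distance_moment p (path_space p T X) \<eta> v u"
    using distance_moment_path_law[OF law uv(2,1), of p] by blast
  have [measurable]: "(\<lambda>\<omega>. ?d (Y u \<omega>) x) \<in> borel_measurable P" "g \<in> borel_measurable P"
    using borel_measurable_path_dist_adapted[OF F ad(1), of x p] x(1) p g(1) by auto
  have "(\<integral>\<^sup>+\<omega>. ennreal (?d (Y v \<omega>) x powr p) \<partial>P)
      \<le> (\<integral>\<^sup>+\<omega>. ennreal (2 powr p) * (g \<omega> + ennreal (?d (Y u \<omega>) x powr p)) \<partial>P)"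
  proof (rule nn_integral_mono_AE, use g(2) AE_space in eventually_elim)
    case (elim \<omega>)
    have mem: "Y u \<omega> \<in> mspace (path_space p T X)" "Y v \<omega> \<in> mspace (path_space p T X)"
      using ad elim(2) p by (auto simp: adapted_def)
    have "?d (Y v \<omega>) x powr p \<le> (?d (Y v \<omega>) (Y u \<omega>) + ?d (Y u \<omega>) x) powr p"
      using p mem x(1) by (intro powr_mono2 mdist_triangle mdist_nonneg) auto
    also have "\<dots> \<le> 2 powr p * (?d (Y v \<omega>) (Y u \<omega>) powr p + ?d (Y u \<omega>) x powr p)"
      using p by (intro powr_add_le mdist_nonneg) auto
    finally show ?case
      unfolding elim(1) by (simp add: ennreal_leI flip: ennreal_plus ennreal_mult)
  qed
  also have "\<dots> = ennreal (2 powr p) * ((\<integral>\<^sup>+\<omega>. g \<omega> \<partial>P) + (\<integral>\<^sup>+\<omega>. ennreal (?d (Y u \<omega>) x powr p) \<partial>P))"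
    by (simp add: nn_integral_cmult nn_integral_add)
  also have "\<dots> < \<infinity>"
    using fin x(2) by (simp add: g(3) ennreal_mult_less_top)
  finally show ?thesis using F ad(2) x(1) unfolding FP_def by auto
qed

lemma metric_speed_powr_le:
  assumes p: "1 \<le> p" and x: "0 \<le> c"
    and bound: "\<And>e. 0 < e \<Longrightarrow> \<exists>d>0. \<forall>y\<in>{0..1}. y \<noteq> x \<longrightarrow> \<bar>y - x\<bar> < d \<longrightarrow>
      D (f x) (f y) \<le> ennreal ((c + e) powr (1 / p) * \<bar>y - x\<bar>)"
  shows "ennreal_powr (metric_speed D f x) p \<le> ennreal c"
proof (rule ennreal_le_epsilon)
  fix e :: real assume e: "0 < e"
  obtain d where d: "0 < d" "\<And>y. y \<in> {0..1} \<Longrightarrow> y \<noteq> x \<Longrightarrow> \<bar>y - x\<bar> < d \<Longrightarrow>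
      D (f x) (f y) \<le> ennreal ((c + e) powr (1 / p) * \<bar>y - x\<bar>)"
    using bound[OF e] by blast
  have "D (f x) (f y) / ennreal \<bar>x - y\<bar> \<le> ennreal ((c + e) powr (1 / p))"
    if "y \<in> {0..1}" "y \<noteq> x" "dist y x < d" for y
  proof -
    have "D (f x) (f y) / ennreal \<bar>x - y\<bar> \<le> ennreal ((c + e) powr (1 / p) * \<bar>y - x\<bar>) / ennreal \<bar>x - y\<bar>"
      using d(2)[of y] that by (intro divide_right_mono_ennreal) (auto simp: dist_real_def)
    also have "\<dots> = ennreal ((c + e) powr (1 / p))"
      using that(2) by (simp add: divide_ennreal abs_minus_commute)
    finally show ?thesis .
  qed
  then have "metric_speed D f x \<le> ennreal ((c + e) powr (1 / p))"
    unfolding metric_speed_def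
    by (intro Limsup_bounded) (auto simp: eventually_at intro!: exI[of _ d] d(1))
  then have "ennreal_powr (metric_speed D f x) p \<le> ennreal_powr (ennreal ((c + e) powr (1 / p))) p"
    using p by (intro ennreal_powr_mono) auto
  also have "\<dots> = ennreal (c + e)"
    using p x e by (simp add: ennreal_powr_ennreal powr_powr)
  finally show "ennreal_powr (metric_speed D f x) p \<le> ennreal c + ennreal e"
    using x e by (simp flip: ennreal_plus)
qed

theorem theorem3p2:
  fixes p :: real and T :: nat and X :: "nat \<Rightarrow> 'a metric"
    and P :: "'w measure" and F :: "nat \<Rightarrow> 'w measure"
    and Y :: "real \<Rightarrow> 'w \<Rightarrow> nat \<Rightarrow> 'a"
    and \<eta> :: "(real \<Rightarrow> nat \<Rightarrow> 'a) measure"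
  assumes "1 \<le> p"
    and "\<And>t. t \<in> {1..T} \<Longrightarrow> mcomplete_of (X t) \<and> separable_space (mtopology_of (X t))"
    and "filtered_prob_space T P F"
    and "\<And>u. u \<in> {0..1} \<Longrightarrow> adapted T X P F (Y u)"
    and "has_path_law P (path_space p T X) Y \<eta>"
    and "AE f in \<eta>. f \<in> AC p (mspace (path_space p T X)) (emdist (path_space p T X))"
    and "\<lparr>prob_of = P, filt = F, proc = Y 0\<rparr> \<in> FP p T X"
    and "(\<integral>\<^sup>+ f. (\<integral>\<^sup>+ s\<in>{0..1}.
            ennreal_powr (metric_speed (emdist (path_space p T X)) f s) p \<partial>lborel) \<partial>\<eta>) < \<infinity>"
  shows "(\<lambda>u. \<lparr>prob_of = P, filt = F, proc = Y u\<rparr>) \<in> AC p (FP p T X) (AW p T X)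
    \<and> (AE u in lborel. u \<in> {0..1} \<longrightarrow>
         ennreal_powr (metric_speed (AW p T X) (\<lambda>u. \<lparr>prob_of = P, filt = F, proc = Y u\<rparr>) u) p
           \<le> (\<integral>\<^sup>+ f. ennreal_powr (metric_speed (emdist (path_space p T X)) f u) p \<partial>\<eta>))"
proof -
  let ?m = "path_space p T X"
  let ?Y = "\<lambda>u. \<lparr>prob_of = P, filt = F, proc = Y u\<rparr>"
  interpret random_curve \<eta> p ?m
    using assms(1,3,5,6) by (intro path_law_random_curve[of p P]) (auto simp: filtered_prob_space_def)
  interpret finite_energy_random_curve \<eta> p ?m
    by unfold_locales (simp only: nn_integral_speed_moment assms(8))
  note AW_le = AW_le_distance_moment[OF assms(1,3,5)]
  have FP: "?Y u \<in> FP p T X" if u: "u \<in> {0..1}" for u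
  proof (rule FP_of_finite_distance_moment[OF assms(1,3) _ _ assms(5,7) _ u])
    have "distance_moment p ?m \<eta> 0 u < \<infinity>"
      using distance_moment_le_ac_density[of 0 u] u by (auto intro: le_less_trans)
    then show "distance_moment p ?m \<eta> u 0 < \<infinity>" by (simp add: distance_moment_commute)
  qed (use assms(4) u in auto)
  have AW_ac_density: "AW p T X (?Y u) (?Y v) \<le> ennreal (LINT s:{u..v}|lborel. ac_density s)"
    if uv: "0 \<le> u" "u \<le> v" "v \<le> 1" for u v
  proof -
    have ac0: "0 \<le> (LINT s:{u..v}|lborel. ac_density s)"
      unfolding set_lebesgue_integral_def using order_trans[OF zero_le_one ac_density_ge_1]
      by (intro Bochner_Integration.integral_nonneg) auto
    have "AW p T X (?Y u) (?Y v) \<le> ennreal_powr (distance_moment p ?m \<eta> u v) (1 / p)"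
      using AW_le[of u v] uv by auto
    also have "\<dots> \<le> ennreal_powr (ennreal ((LINT s:{u..v}|lborel. ac_density s) powr p)) (1 / p)"
      using p by (intro ennreal_powr_mono distance_moment_le_ac_density uv) auto
    also have "\<dots> = ennreal (LINT s:{u..v}|lborel. ac_density s)"
      using p ac0 by (simp add: ennreal_powr_ennreal powr_powr)
    finally show ?thesis .
  qed
  have "?Y \<in> AC p (FP p T X) (AW p T X)"
    unfolding AC_def
  proof (intro CollectI conjI exI[of _ ac_density] allI impI)
    show "set_borel_measurable lborel {0..1} ac_density" by (simp add: set_borel_measurable_def)
    have "\<bar>ac_density s\<bar> powr p = 1 + energy_density s" for s using ac_density_ge_1[of s] by (simp add: ac_density_powr_p)
    then show "set_integrable lborel {0..1} (\<lambda>r. \<bar>ac_density r\<bar> powr p)" using set_integrable_1_plus_energy by simp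
  qed (use FP AW_ac_density in auto)
  moreover have "AE u in lborel. u \<in> {0..1} \<longrightarrow>
         ennreal_powr (metric_speed (AW p T X) ?Y u) p
           \<le> (\<integral>\<^sup>+ f. ennreal_powr (metric_speed (emdist ?m) f u) p \<partial>\<eta>)"
  proof -
    obtain N where N: "negligible N"
      "\<And>x e. x \<in> {0..1} - N \<Longrightarrow> 0 < e \<Longrightarrow> \<exists>d>0. \<forall>y\<in>{0..1}. y \<noteq> x \<longrightarrow> \<bar>y - x\<bar> < d \<longrightarrow>
        distance_moment p ?m \<eta> x y \<le> ennreal ((energy_density x + e) * \<bar>y - x\<bar> powr p)"
      using distance_moment_local by blast
    have "AE x in completion lborel. x \<notin> N"
      using N(1) by (intro AE_not_in) (simp add: negligible_iff_null_sets)
    then have "AE x in lborel. x \<notin> N" by (simp add: AE_completion_iff)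
    with AE_K_eq_energy_density show ?thesis
    proof eventually_elim
      case (elim x)
      show ?case
      proof
        assume x: "x \<in> {0..1}"
        have "ennreal_powr (metric_speed (AW p T X) ?Y x) p \<le> ennreal (energy_density x)"
        proof (rule metric_speed_powr_le[OF p energy_density_nonneg])
          fix e :: real assume e: "0 < e"
          obtain d where d: "0 < d" "\<And>y. y \<in> {0..1} \<Longrightarrow> y \<noteq> x \<Longrightarrow> \<bar>y - x\<bar> < d \<Longrightarrow>
              distance_moment p ?m \<eta> x y \<le> ennreal ((energy_density x + e) * \<bar>y - x\<bar> powr p)"
            using N(2)[of x e] x elim(2) e by blast
          have "AW p T X (?Y x) (?Y y) \<le> ennreal ((energy_density x + e) powr (1 / p) * \<bar>y - x\<bar>)"
            if y: "y \<in> {0..1}" "y \<noteq> x" "\<bar>y - x\<bar> < d" for y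
          proof -
            have "AW p T X (?Y x) (?Y y) \<le> ennreal_powr (ennreal ((energy_density x + e) * \<bar>y - x\<bar> powr p)) (1 / p)"
              using p by (intro order_trans[OF AW_le[OF x y(1)]] ennreal_powr_mono d(2) y) auto
            also have "\<dots> = ennreal ((energy_density x + e) powr (1 / p) * \<bar>y - x\<bar>)"
              using p e energy_density_nonneg[of x] by (simp add: ennreal_powr_ennreal powr_mult powr_powr)
            finally show ?thesis .
          qed
          then show "\<exists>d>0. \<forall>y\<in>{0..1}. y \<noteq> x \<longrightarrow> \<bar>y - x\<bar> < d \<longrightarrow>
              AW p T X (?Y x) (?Y y) \<le> ennreal ((energy_density x + e) powr (1 / p) * \<bar>y - x\<bar>)"
            using d(1) by blast
        qed
        then show "ennreal_powr (metric_speed (AW p T X) ?Y x) p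
            \<le> (\<integral>\<^sup>+ f. ennreal_powr (metric_speed (emdist ?m) f x) p \<partial>\<eta>)"
          by (simp only: elim(1)[symmetric] speed_moment_eq[OF x])
      qed
    qed
  qed
  ultimately show ?thesis by blast
qed

end
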